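(* Let $$\nu_{1} = m(\overline{23}331113^*3\overline{32})=3.94254\dots,$$ $$\mu_{1} = m(\overline{23}3311133113212311333^*111331113331132123113311133\overline{32})=3.943304\dots,$$ $$\nu_{2} = m(\overline{12}31133311133111331113^*33113\overline{21})=3.94330534\dots,$$ $$\mu_{2} = m(\overline{21}11331113^*331132123113311133\overline{32})=3.94330716\dots.$$ The intervals $(\nu_i,\mu_i)$, $i=1,2$, are maximal gaps of $M$; i.e., $(\nu_i,\mu_i)\cap M=\varnothing$ and $\nu_i,\mu_i\in M$.
   Context: For $\underline a=(a_i)_{i\in\mathbb Z}\in(\mathbb N_{>0})^{\mathbb Z}$ and $j\in\mathbb Z$ let $\lambda_j(\underline a)=[a_j;a_{j+1},a_{j+2},\ldots]+[0;a_{j-1},a_{j-2},\ldots]$ and $m(\underline a)=\sup_{j\in\mathbb Z}\lambda_j(\underline a)$. The Markov spectrum $M\subset\mathbb R$ is the set of finite values $m(\underline a)$. Sequences are written as concatenations of one-digit terms; an overline at the left (right) end denotes infinite periodic repetition to the left (right), and the asterisk marks the entry of index $0$. When a Markov value is written $m(\ldots a_{-1}a_0^*a_1\ldots)$ it is meant that the supremum is attained at the marked position, i.e. $m(\ldots a_0^*\ldots)=\lambda_0(\ldots a_0^*\ldots)$. *)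

theory Defs
  imports Complex_Main
begin

text \<open>The finite continued fraction $[a_0; a_1, \ldots, a_n]$ and its limit
  $[a_0; a_1, a_2, \ldots]$.  The limit exists whenever $a_k > 0$ for all $k \ge 1$;
  $a_0 = 0$ is allowed.\<close>

fun cfrac_fin :: "(nat \<Rightarrow> nat) \<Rightarrow> nat \<Rightarrow> real" where
  "cfrac_fin a 0 = real (a 0)"
| "cfrac_fin a (Suc n) = real (a 0) + 1 / cfrac_fin (\<lambda>k. a (Suc k)) n"

definition cfrac :: "(nat \<Rightarrow> nat) \<Rightarrow> real" where
  "cfrac a = lim (\<lambda>n. cfrac_fin a n)"

definition markov_lambda :: "(int \<Rightarrow> nat) \<Rightarrow> int \<Rightarrow> real" where
  "markov_lambda a j =
     cfrac (\<lambda>k. a (j + int k)) + cfrac (\<lambda>k. if k = 0 then 0 else a (j - int k))"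

text \<open>A real supremum, hence only meaningful for sequences with bounded
  \<^const>\<open>markov_lambda\<close>; the others, where the supremum is $\infty$, are
  excluded in \<open>markov_spectrum\<close> below.\<close>

definition markov_value :: "(int \<Rightarrow> nat) \<Rightarrow> real" where
  "markov_value a = (SUP j. markov_lambda a j)"

definition markov_spectrum :: "real set" where
  "markov_spectrum =
     {markov_value a | a. (\<forall>j. a j > 0) \<and> bdd_above (range (markov_lambda a))}"

text \<open>The meaning of the asterisk: the supremum is finite and attained at index 0.\<close>

definition attained_at_mark :: "(int \<Rightarrow> nat) \<Rightarrow> bool" where
  "attained_at_mark a \<longleftrightarrow>
     bdd_above (range (markov_lambda a)) \<and> markov_value a = markov_lambda a 0"

text \<open>\<open>marked_seq p u c v q\<close> is the bi-infinite word
  $\overline{p}\, u\, c^*\, v\, \overline{q}$ with the digit $c$ at index 0.  All words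
  are read from left to right, so the negative indices run backwards through \<open>u\<close> and then
  through \<open>p\<close>.\<close>

definition eventually_periodic :: "nat list \<Rightarrow> nat list \<Rightarrow> nat \<Rightarrow> nat" where
  "eventually_periodic w p k =
     (if k < length w then w ! k else p ! ((k - length w) mod length p))"

definition marked_seq ::
  "nat list \<Rightarrow> nat list \<Rightarrow> nat \<Rightarrow> nat list \<Rightarrow> nat list \<Rightarrow> int \<Rightarrow> nat" where
  "marked_seq p u c v q j =
     (if j = 0 then c
      else if j > 0 then eventually_periodic v q (nat (j - 1))
      else eventually_periodic (rev u) (rev p) (nat (- j - 1)))"

definition nu1_seq :: "int \<Rightarrow> nat" where
  "nu1_seq = marked_seq [2, 3]
     [3, 3, 1, 1, 1]
     3
     [3]
     [3, 2]"

definition mu1_seq :: "int \<Rightarrow> nat" where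
  "mu1_seq = marked_seq [2, 3]
     [3, 3, 1, 1, 1, 3, 3, 1, 1, 3, 2, 1, 2, 3, 1, 1, 3, 3]
     3
     [1, 1, 1, 3, 3, 1, 1, 1, 3, 3, 3, 1, 1, 3, 2, 1, 2, 3, 1, 1, 3, 3, 1, 1, 1, 3, 3]
     [3, 2]"

definition nu2_seq :: "int \<Rightarrow> nat" where
  "nu2_seq = marked_seq [1, 2]
     [3, 1, 1, 3, 3, 3, 1, 1, 1, 3, 3, 1, 1, 1, 3, 3, 1, 1, 1]
     3
     [3, 3, 1, 1, 3]
     [2, 1]"

definition mu2_seq :: "int \<Rightarrow> nat" where
  "mu2_seq = marked_seq [2, 1]
     [1, 1, 3, 3, 1, 1, 1]
     3
     [3, 3, 1, 1, 3, 2, 1, 2, 3, 1, 1, 3, 3, 1, 1, 1, 3, 3]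
     [3, 2]"

definition nu1 :: real where
  "nu1 = markov_value nu1_seq"

definition mu1 :: real where
  "mu1 = markov_value mu1_seq"

definition nu2 :: real where
  "nu2 = markov_value nu2_seq"

definition mu2 :: real where
  "mu2 = markov_value mu2_seq"

end

theory Submission
  imports Defs "HOL-Library.Sublist" "HOL-Library.Code_Binary_Nat"
begin

text \<open>A value below 4 forces digits at most 3, so after a shift a point of $M$ in the gap is
  given by a ternary sequence with $\lambda_0 > \nu_i$ and all $\lambda_j < \mu_i$. Branching on
  the digits around index 0 and bounding continued fractions on cylinders, a finite tree leaves,
  up to reflection, only the sequences containing the central word of $\nu_i$ or of $\mu_i$ at
  index 0. Behind these words, the words 3231 and 213 being forbidden, the periodic tails are extremal
  for the alternating lexicographic order, which yields $\lambda_0 \le \nu_i$ and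
  $\lambda_j \ge \mu_i$ for some $j$, respectively.\<close>

section \<open>Infinite continued fractions\<close>

text \<open>Rational bounds alone cannot finish the tree: the rationals lie just outside the gap, so
  the sequences of \<nu>_i and \<mu>_i themselves survive every test. Their branches are therefore
  cut at a finite core, and the infinitely many continuations of a core are settled by comparing
  digits. Parity decides the direction of that comparison: behind a prefix of odd length the
  periodic tail gives the largest continued fraction, as \<nu>_i requires, and behind one of even
  length the smallest, as \<mu>_i requires. The long side of \<mu>_1 has the wrong parity and forces
  an argument with two indices. A second obstacle is symmetry: three of the four words are
  palindromic, so the supremum is reached at two indices. No numerical estimate separates equal
  values, and these ties get arguments of their own. All numerical tests are cross-multiplied into
  inequalities between natural numbers, so that they can be decided by evaluation.\<close>

lemma cfrac_fin_bounds:
  assumes "\<And>k. 0 < a (Suc k)"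
  shows "real (a 0) \<le> cfrac_fin a n \<and> cfrac_fin a n \<le> real (a 0) + 1"
  using assms
proof (induction n arbitrary: a)
  case (Suc n)
  have "real (a (Suc 0)) \<le> cfrac_fin (\<lambda>k. a (Suc k)) n"
    using Suc.IH[of "\<lambda>k. a (Suc k)"] Suc.prems by simp
  moreover have "real (a (Suc 0)) \<ge> 1"
    using Suc.prems[of 0] by linarith
  ultimately show ?case by simp
qed simp

text \<open>A single inversion has derivative of modulus 1 at x = 1 and need not contract. Two steps
  together divide by \<open>(d * x + 1) * (d * y + 1)\<close>, which is at least 4.\<close>

lemma two_step_contraction:
  fixes d x y :: real
  assumes "d \<ge> 1" "x \<ge> 1" "y \<ge> 1"
  shows "\<bar>1 / (d + 1 / x) - 1 / (d + 1 / y)\<bar> \<le> \<bar>x - y\<bar> / 4"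
proof -
  have dx: "d * x \<ge> 1" "d * y \<ge> 1"
    using assms mult_mono[of 1 d 1 x] mult_mono[of 1 d 1 y] by auto
  have "1 / (d + 1 / x) - 1 / (d + 1 / y) = (x - y) / ((d * x + 1) * (d * y + 1))"
  proof -
    have *: "1 / (d + 1 / x) = x / (d * x + 1)" "1 / (d + 1 / y) = y / (d * y + 1)"
      using assms by (auto simp: divide_simps)
    have "d * x + 1 \<noteq> 0" "d * y + 1 \<noteq> 0" using dx by auto
    then show ?thesis unfolding * by (simp add: diff_frac_eq algebra_simps)
  qed
  moreover have "(d * x + 1) * (d * y + 1) \<ge> 2 * 2"
    using dx by (intro mult_mono) auto
  moreover from this have "\<bar>x - y\<bar> / ((d * x + 1) * (d * y + 1)) \<le> \<bar>x - y\<bar> / 4"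
    by (intro divide_left_mono) auto
  ultimately show ?thesis
    using dx by (simp add: abs_mult)
qed

lemma cfrac_fin_diff:
  assumes "\<And>k. 0 < a (Suc k)" "2 * k \<le> n" "2 * k \<le> m"
  shows "\<bar>cfrac_fin a n - cfrac_fin a m\<bar> \<le> (1 / 4) ^ k"
  using assms
proof (induction k arbitrary: a n m)
  case 0
  then show ?case
    using cfrac_fin_bounds[of a n] cfrac_fin_bounds[of a m] by force
next
  case (Suc k)
  define b where "b = (\<lambda>k. a (Suc (Suc k)))"
  obtain n' where n: "n = Suc (Suc n')" "2 * k \<le> n'"
    using Suc.prems(2) by (intro that[of "n - 2"]) auto
  obtain m' where m: "m = Suc (Suc m')" "2 * k \<le> m'"
    using Suc.prems(3) by (intro that[of "m - 2"]) auto
  have b1: "real (b 0) \<ge> 1" "real (a (Suc 0)) \<ge> 1"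
    using Suc.prems(1)[of 1] Suc.prems(1)[of 0] unfolding b_def by auto
  have bp: "0 < b (Suc i)" for i
    using Suc.prems(1) by (simp add: b_def)
  have "cfrac_fin b n' \<ge> 1" "cfrac_fin b m' \<ge> 1"
    using cfrac_fin_bounds[of b n'] cfrac_fin_bounds[of b m'] bp b1 by auto
  moreover have "\<bar>cfrac_fin b n' - cfrac_fin b m'\<bar> \<le> (1 / 4) ^ k"
    using bp n(2) m(2) by (intro Suc.IH) auto
  ultimately show ?case
    using two_step_contraction[of "real (a (Suc 0))" "cfrac_fin b n'" "cfrac_fin b m'"] b1
    by (simp add: n m b_def)
qed

lemma cfrac_fin_tendsto:
  assumes "\<And>k. 0 < a (Suc k)"
  shows "cfrac_fin a \<longlonglongrightarrow> cfrac a"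
proof -
  have "Cauchy (cfrac_fin a)"
  proof (rule CauchyI)
    fix e :: real assume "0 < e"
    then obtain k where k: "(1 / 4 :: real) ^ k < e"
      using real_arch_pow_inv[of e "1/4"] by auto
    show "\<exists>M. \<forall>m\<ge>M. \<forall>n\<ge>M. norm (cfrac_fin a m - cfrac_fin a n) < e"
      using cfrac_fin_diff[of a k] assms k
      by (intro exI[of _ "2 * k"]) (auto intro: le_less_trans)
  qed
  then show ?thesis
    unfolding cfrac_def by (simp add: Cauchy_convergent_iff convergent_LIMSEQ_iff)
qed

lemma cfrac_ge:
  assumes "\<And>k. 0 < a (Suc k)"
  shows "real (a 0) \<le> cfrac a"
  using cfrac_fin_bounds[of a] assms
  by (intro LIMSEQ_le_const[OF cfrac_fin_tendsto]) auto

text \<open>The leading digit is left unrestricted because the backward half of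
  \<open>markov_lambda\<close> has leading digit 0.\<close>

lemma cfrac_unfold:
  assumes "\<And>k. 0 < a (Suc k)"
  shows "cfrac a = real (a 0) + 1 / cfrac (\<lambda>k. a (Suc k))"
proof -
  have "real (a (Suc 0)) \<le> cfrac (\<lambda>k. a (Suc k))"
    by (rule cfrac_ge) (rule assms)
  then have "cfrac (\<lambda>k. a (Suc k)) \<noteq> 0"
    using assms[of 0] by linarith
  then have "(\<lambda>n. cfrac_fin a (Suc n)) \<longlonglongrightarrow> real (a 0) + 1 / cfrac (\<lambda>k. a (Suc k))"
    using cfrac_fin_tendsto[of "\<lambda>k. a (Suc k)"] assms
    by (auto intro!: tendsto_intros)
  then show ?thesis
    using LIMSEQ_Suc[OF cfrac_fin_tendsto[of a]] assms LIMSEQ_unique by blast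
qed

text \<open>This is [0; b_0, b_1, ...]. With it \<lambda>_j is a digit plus two tails of the same
  kind, both read outwards, so that one set of estimates serves both sides.\<close>

definition tail_frac :: "(nat \<Rightarrow> nat) \<Rightarrow> real" where
  "tail_frac b = 1 / cfrac b"

lemma tail_frac_unfold:
  assumes "\<And>k. 0 < b k"
  shows "tail_frac b = 1 / (real (b 0) + tail_frac (\<lambda>k. b (Suc k)))"
  unfolding tail_frac_def using cfrac_unfold[of b] assms by simp

lemma tail_frac_pos:
  assumes "\<And>k. 0 < b k"
  shows "0 < tail_frac b"
proof -
  have "real (b 0) \<le> cfrac b" by (rule cfrac_ge) (rule assms)
  then have "cfrac b > 0" using assms[of 0] by linarith
  then show ?thesis by (simp add: tail_frac_def)
qed

lemma tail_frac_le:
  assumes "\<And>k. 0 < b k"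
  shows "tail_frac b \<le> 1 / real (b 0)"
  using tail_frac_unfold[of b] tail_frac_pos[of "\<lambda>k. b (Suc k)"] assms
  by (simp add: frac_le)

lemma tail_frac_ge:
  assumes "\<And>k. 0 < b k"
  shows "1 / (real (b 0) + 1) \<le> tail_frac b"
proof -
  have "tail_frac (\<lambda>k. b (Suc k)) \<le> 1 / real (b (Suc 0))"
    using tail_frac_le[of "\<lambda>k. b (Suc k)"] assms by simp
  also have "\<dots> \<le> 1" using assms[of "Suc 0"] by simp
  finally show ?thesis
    using tail_frac_unfold[of b] tail_frac_pos[of "\<lambda>k. b (Suc k)"] assms
    by (simp add: frac_le)
qed

lemma markov_lambda_eq:
  assumes "\<And>i. 0 < a i"
  shows "markov_lambda a j = real (a j) + tail_frac (\<lambda>k. a (j + 1 + int k)) +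
    tail_frac (\<lambda>k. a (j - 1 - int k))"
proof -
  have "cfrac (\<lambda>k. a (j + int k)) = real (a j) + tail_frac (\<lambda>k. a (j + 1 + int k))"
    using cfrac_unfold[of "\<lambda>k. a (j + int k)"] assms
    by (simp add: tail_frac_def algebra_simps)
  moreover have "cfrac (\<lambda>k. if k = 0 then 0 else a (j - int k)) =
      tail_frac (\<lambda>k. a (j - 1 - int k))"
    using cfrac_unfold[of "\<lambda>k. if k = 0 then 0 else a (j - int k)"] assms
    by (simp add: tail_frac_def algebra_simps)
  ultimately show ?thesis by (simp add: markov_lambda_def)
qed

section \<open>The alternating lexicographic order on tails\<close>

lemma tail_frac_less_digit:
  assumes b: "\<And>k. 0 < b k" and c: "\<And>k. 0 < c k"
    and "\<And>i. i < k \<Longrightarrow> b i = c i" "b k < c k"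
  shows "if even k then tail_frac c \<le> tail_frac b else tail_frac b \<le> tail_frac c"
  using assms
proof (induction k arbitrary: b c)
  case 0
  \<comment> \<open>A tail with first digit d lies between 1/(d+1) and 1/d, so distinct first digits
    give intervals that meet at most in an endpoint.\<close>
  have "tail_frac c \<le> 1 / real (c 0)" by (rule tail_frac_le) (rule 0)
  also have "\<dots> \<le> 1 / (real (b 0) + 1)"
    using 0(4) by (intro divide_left_mono) auto
  also have "\<dots> \<le> tail_frac b" by (rule tail_frac_ge) (rule 0)
  finally show ?case by simp
next
  case (Suc k)
  let ?b = "\<lambda>i. b (Suc i)" and ?c = "\<lambda>i. c (Suc i)"
  \<comment> \<open>Each common digit applies a decreasing map and reverses the order once.\<close>
  have "if even k then tail_frac ?c \<le> tail_frac ?b else tail_frac ?b \<le> tail_frac ?c"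
    using Suc.prems by (intro Suc.IH) auto
  moreover have "tail_frac b = 1 / (real (b 0) + tail_frac ?b)"
      "tail_frac c = 1 / (real (b 0) + tail_frac ?c)"
    using Suc.prems(3)[of 0] tail_frac_unfold[of b] tail_frac_unfold[of c] Suc.prems(1,2)
    by simp_all
  moreover have "tail_frac ?b > 0" "tail_frac ?c > 0"
    using Suc.prems(1,2) by (auto intro: tail_frac_pos)
  ultimately show ?case
    by (auto intro!: frac_le split: if_splits)
qed

text \<open>Only the first disagreement matters. The digit condition may assume agreement up to k,
  which is what later allows a forbidden word to be completed from known digits.\<close>

lemma tail_frac_le_if_digitwise:
  assumes b: "\<And>k. 0 < b k" and c: "\<And>k. 0 < c k"
    and le: "\<And>k. (\<And>i. i < k \<Longrightarrow> b i = c i) \<Longrightarrow> if even k then c k \<le> b k else b k \<le> c k"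
  shows "tail_frac b \<le> tail_frac c"
proof (cases "b = c")
  case False
  then have ex: "\<exists>k. b k \<noteq> c k" by auto
  define k where "k = (LEAST k. b k \<noteq> c k)"
  have ne: "b k \<noteq> c k" using LeastI_ex[OF ex] by (simp add: k_def)
  have eq: "b i = c i" if "i < k" for i
    using not_less_Least[of i "\<lambda>k. b k \<noteq> c k"] that by (auto simp: k_def)
  show ?thesis
  proof (cases "even k")
    case True
    then have "c k < b k" using le[of k] eq ne by auto
    then show ?thesis
      using tail_frac_less_digit[OF c b, of k] eq True by auto
  next
    case False
    then have "b k < c k" using le[of k] eq ne by auto
    then show ?thesis
      using tail_frac_less_digit[OF b c, of k] eq False by auto
  qed
qed simp

section \<open>Rational bounds on cylinders\<close>

definition ternary :: "(nat \<Rightarrow> nat) \<Rightarrow> bool" where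
  "ternary b \<longleftrightarrow> (\<forall>k. b k \<in> {1, 2, 3})"

lemma ternary_Suc: "ternary b \<Longrightarrow> ternary (\<lambda>k. b (Suc k))"
  by (simp add: ternary_def)

lemma ternary_pos: "ternary b \<Longrightarrow> 0 < b k"
  by (metis ternary_def insertE less_numeral_extra(1) singletonD zero_less_numeral)

lemma ternary_le: "ternary b \<Longrightarrow> b k \<le> 3"
  unfolding ternary_def by (drule spec[of _ k]) auto

lemma ternary_unfold:
  "ternary b \<Longrightarrow> tail_frac b = 1 / (real (b 0) + tail_frac (\<lambda>k. b (Suc k)))"
  by (rule tail_frac_unfold) (rule ternary_pos)

text \<open>Iterating the trivial bounds $1/4 \le x \le 1$ gives $4/5$, $5/19$ and $19/24$.\<close>

lemma ternary_tail_frac_bounds: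
  assumes "ternary b"
  shows "5 / 19 \<le> tail_frac b" "tail_frac b \<le> 19 / 24"
proof -
  have digits: "1 \<le> real (b 0)" "real (b 0) \<le> 3" if "ternary b" for b
    using ternary_pos[OF that, of 0] ternary_le[OF that, of 0] by auto
  have 1: "1 / 4 \<le> tail_frac b" if "ternary b" for b
  proof -
    have "1 / 4 \<le> 1 / (real (b 0) + 1)" using digits[OF that] by (intro frac_le) auto
    also have "\<dots> \<le> tail_frac b" by (rule tail_frac_ge) (rule ternary_pos[OF that])
    finally show ?thesis .
  qed
  have 2: "tail_frac b \<le> 4 / 5" if "ternary b" for b
  proof -
    have "1 / (real (b 0) + tail_frac (\<lambda>k. b (Suc k))) \<le> 1 / (1 + 1 / 4)"
      using digits[OF that] 1[OF ternary_Suc[OF that]] by (intro frac_le) auto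
    then show ?thesis using ternary_unfold[OF that] by simp
  qed
  have 3: "5 / 19 \<le> tail_frac b" if "ternary b" for b
  proof -
    have "1 / (3 + 4 / 5) \<le> 1 / (real (b 0) + tail_frac (\<lambda>k. b (Suc k)))"
      using digits[OF that] 1[OF ternary_Suc[OF that]] 2[OF ternary_Suc[OF that]]
      by (intro frac_le) auto
    then show ?thesis using ternary_unfold[OF that] by simp
  qed
  show "5 / 19 \<le> tail_frac b" by (rule 3) fact
  have "1 / (real (b 0) + tail_frac (\<lambda>k. b (Suc k))) \<le> 1 / (1 + 5 / 19)"
    using digits[OF assms] 3[OF ternary_Suc[OF assms]] by (intro frac_le) auto
  then show "tail_frac b \<le> 19 / 24" using ternary_unfold[OF assms] by simp
qed

fun starts :: "(nat \<Rightarrow> nat) \<Rightarrow> nat list \<Rightarrow> bool" where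
  "starts b [] = True"
| "starts b (x # w) = (b 0 = x \<and> starts (\<lambda>k. b (Suc k)) w)"

lemma starts_append:
  "starts b (v @ w) \<longleftrightarrow> starts b v \<and> starts (\<lambda>k. b (length v + k)) w"
  by (induction v arbitrary: b) auto

text \<open>A fraction (numerator, denominator) bounding $[0; w, \ldots]$ from above if the flag is
  set, and from below otherwise.\<close>

fun cyl_bound :: "bool \<Rightarrow> nat list \<Rightarrow> nat \<times> nat" where
  "cyl_bound up [] = (if up then (19, 24) else (5, 19))"
| "cyl_bound up (y # w) = (case cyl_bound (\<not> up) w of (n, d) \<Rightarrow> (d, y * d + n))"

lemma cyl_bound_pos:
  "cyl_bound up w = (n, d) \<Longrightarrow> 0 < n \<and> 0 < d"
  by (induction w arbitrary: up n d) (auto split: prod.splits if_splits)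

text \<open>Since t \<mapsto> 1/(y + t) decreases, an upper bound needs a lower bound for the
  remaining digits; hence the flag alternates along the word.\<close>

lemma cyl_bound_sound:
  assumes "ternary b" "starts b w" "cyl_bound up w = (n, d)"
  shows "if up then tail_frac b \<le> real n / real d else real n / real d \<le> tail_frac b"
  using assms
proof (induction w arbitrary: b up n d)
  case Nil
  then show ?case using ternary_tail_frac_bounds[of b] by (auto split: if_splits)
next
  case (Cons y w)
  obtain p q where pq: "cyl_bound (\<not> up) w = (p, q)" by fastforce
  have nd: "n = q" "d = y * q + p" using Cons.prems pq by auto
  have pos: "0 < p" "0 < q" using cyl_bound_pos[OF pq] by auto
  let ?t = "tail_frac (\<lambda>k. b (Suc k))"
  have IH: "if \<not> up then ?t \<le> real p / real q else real p / real q \<le> ?t"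
    using Cons.IH[OF ternary_Suc[OF Cons.prems(1)] _ pq] Cons.prems(2) by simp
  have t: "0 < ?t" using ternary_pos[OF Cons.prems(1)] by (intro tail_frac_pos)
  have b: "tail_frac b = 1 / (real y + ?t)"
    using ternary_unfold[OF Cons.prems(1)] Cons.prems(2) by simp
  have "real n / real d = 1 / (real y + real p / real q)"
    using pos by (simp add: nd field_simps)
  moreover have "0 < real p / real q" using pos by simp
  ultimately show ?case
    using IH t by (auto simp: b intro!: frac_le split: if_splits simp del: divide_eq_eq)
qed

text \<open>In a window, the left word is listed outwards, that is, from right to left.\<close>

definition window :: "(int \<Rightarrow> nat) \<Rightarrow> int \<Rightarrow> nat list \<Rightarrow> nat \<Rightarrow> nat list \<Rightarrow> bool" where
  "window a j l x r \<longleftrightarrow>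
     a j = x \<and> starts (\<lambda>k. a (j + 1 + int k)) r \<and> starts (\<lambda>k. a (j - 1 - int k)) l"

definition ternary2 :: "(int \<Rightarrow> nat) \<Rightarrow> bool" where
  "ternary2 a \<longleftrightarrow> (\<forall>i. a i \<in> {1, 2, 3})"

lemma ternary2_halves:
  assumes "ternary2 a"
  shows "ternary (\<lambda>k. a (j + int k))" "ternary (\<lambda>k. a (j - int k))"
  using assms by (simp_all add: ternary_def ternary2_def)

lemma ternary2_pos: "ternary2 a \<Longrightarrow> 0 < a i"
  by (metis ternary2_def insertE less_numeral_extra(1) singletonD zero_less_numeral)

text \<open>The digit plus both cylinder bounds is compared with N/K after clearing denominators, so
  evaluation stays inside the natural numbers.\<close>

definition lambda_le :: "nat \<Rightarrow> nat \<Rightarrow> nat list \<Rightarrow> nat \<Rightarrow> nat list \<Rightarrow> bool" where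
  "lambda_le N K l x r =
     (case cyl_bound True l of (n, d) \<Rightarrow> case cyl_bound True r of (n', d') \<Rightarrow>
        K * (x * (d * d') + n * d' + n' * d) \<le> N * (d * d'))"

definition lambda_ge :: "nat \<Rightarrow> nat \<Rightarrow> nat list \<Rightarrow> nat \<Rightarrow> nat list \<Rightarrow> bool" where
  "lambda_ge N K l x r =
     (case cyl_bound False l of (n, d) \<Rightarrow> case cyl_bound False r of (n', d') \<Rightarrow>
        N * (d * d') \<le> K * (x * (d * d') + n * d' + n' * d))"

lemma window_bound_aux:
  fixes n d n' d' x K N :: nat
  assumes "0 < d" "0 < d'" "0 < K"
  shows "real N / real K \<le> real x + real n' / real d' + real n / real d \<longleftrightarrow>
      N * (d * d') \<le> K * (x * (d * d') + n * d' + n' * d)"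
    and "real x + real n' / real d' + real n / real d \<le> real N / real K \<longleftrightarrow>
      K * (x * (d * d') + n * d' + n' * d) \<le> N * (d * d')"
proof -
  define S where "S = x * (d * d') + n * d' + n' * d"
  have eq: "real x + real n' / real d' + real n / real d = real S / real (d * d')"
    using assms by (simp add: S_def field_simps)
  have pos: "0 < real (d * d')" "0 < real K" using assms by auto
  have "real N / real K \<le> real S / real (d * d') \<longleftrightarrow> real (N * (d * d')) \<le> real (K * S)"
    using pos by (simp add: divide_le_eq le_divide_eq mult.commute)
  then show "real N / real K \<le> real x + real n' / real d' + real n / real d \<longleftrightarrow>
      N * (d * d') \<le> K * (x * (d * d') + n * d' + n' * d)"
    unfolding eq of_nat_le_iff S_def .
  have "real S / real (d * d') \<le> real N / real K \<longleftrightarrow> real (K * S) \<le> real (N * (d * d'))"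
    using pos by (simp add: divide_le_eq le_divide_eq mult.commute)
  then show "real x + real n' / real d' + real n / real d \<le> real N / real K \<longleftrightarrow>
      K * (x * (d * d') + n * d' + n' * d) \<le> N * (d * d')"
    unfolding eq of_nat_le_iff S_def .
qed

lemma lambda_le_sound:
  assumes a: "ternary2 a" and w: "window a j l x r" and le: "lambda_le N K l x r" and K: "0 < K"
  shows "markov_lambda a j \<le> real N / real K"
proof -
  obtain n d where l: "cyl_bound True l = (n, d)" by fastforce
  obtain n' d' where r: "cyl_bound True r = (n', d')" by fastforce
  have "markov_lambda a j = real x + tail_frac (\<lambda>k. a (j + 1 + int k)) +
      tail_frac (\<lambda>k. a (j - 1 - int k))"
    using markov_lambda_eq ternary2_pos[OF a] w by (simp add: window_def)
  also have "\<dots> \<le> real x + real n' / real d' + real n / real d"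
    using cyl_bound_sound[OF ternary2_halves(1)[OF a] _ r, of "j + 1"]
      cyl_bound_sound[OF ternary2_halves(2)[OF a] _ l, of "j - 1"] w
    by (auto simp: window_def)
  also have "\<dots> \<le> real N / real K"
    using window_bound_aux(2)[of d d' K x n' n N] le K cyl_bound_pos[OF l] cyl_bound_pos[OF r]
    by (simp add: lambda_le_def l r)
  finally show ?thesis .
qed

lemma lambda_ge_sound:
  assumes a: "ternary2 a" and w: "window a j l x r" and ge: "lambda_ge N K l x r" and K: "0 < K"
  shows "real N / real K \<le> markov_lambda a j"
proof -
  obtain n d where l: "cyl_bound False l = (n, d)" by fastforce
  obtain n' d' where r: "cyl_bound False r = (n', d')" by fastforce
  have "real N / real K \<le> real x + real n' / real d' + real n / real d"
    using window_bound_aux(1)[of d d' K N x n' n] ge K cyl_bound_pos[OF l] cyl_bound_pos[OF r]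
    by (simp add: lambda_ge_def l r)
  also have "\<dots> \<le> real x + tail_frac (\<lambda>k. a (j + 1 + int k)) +
      tail_frac (\<lambda>k. a (j - 1 - int k))"
    using cyl_bound_sound[OF ternary2_halves(1)[OF a] _ r, of "j + 1"]
      cyl_bound_sound[OF ternary2_halves(2)[OF a] _ l, of "j - 1"] w
    by (auto simp: window_def)
  also have "\<dots> = markov_lambda a j"
    using markov_lambda_eq ternary2_pos[OF a] w by (simp add: window_def)
  finally show ?thesis .
qed

section \<open>The search tree\<close>

lemma window_right: "window a j l x (y # r) \<longleftrightarrow> a j = x \<and> window a (j + 1) (x # l) y r"
  by (auto simp: window_def algebra_simps)

lemma window_left: "window a j (y # l) x r \<longleftrightarrow> a j = x \<and> window a (j - 1) l y (x # r)"
  by (auto simp: window_def algebra_simps)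

text \<open>Moving the centre loses no information, since the digits passed over join the other
  side. A branch can thus be closed by a large value at any known place, not only at the marked
  3.\<close>

fun high_right :: "nat \<Rightarrow> nat \<Rightarrow> nat \<Rightarrow> nat list \<Rightarrow> nat \<Rightarrow> nat list \<Rightarrow> bool" where
  "high_right M K 0 l x r = lambda_ge M K l x r"
| "high_right M K (Suc n) l x r =
     (case r of [] \<Rightarrow> False | y # r' \<Rightarrow> high_right M K n (x # l) y r')"

fun high_left :: "nat \<Rightarrow> nat \<Rightarrow> nat \<Rightarrow> nat list \<Rightarrow> nat \<Rightarrow> nat list \<Rightarrow> bool" where
  "high_left M K 0 l x r = lambda_ge M K l x r"
| "high_left M K (Suc n) l x r =
     (case l of [] \<Rightarrow> False | y # l' \<Rightarrow> high_left M K n l' y (x # r))"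

lemma high_right_sound:
  assumes a: "ternary2 a" and K: "0 < K"
  shows "window a j l x r \<Longrightarrow> high_right M K n l x r \<Longrightarrow>
    \<exists>i. real M / real K \<le> markov_lambda a i"
proof (induction n arbitrary: j l x r)
  case 0
  then show ?case
    by (intro exI[of _ j] lambda_ge_sound[OF a _ _ K, of j l x r M]) auto
next
  case (Suc n)
  then show ?case by (cases r) (auto simp: window_right)
qed

lemma high_left_sound:
  assumes a: "ternary2 a" and K: "0 < K"
  shows "window a j l x r \<Longrightarrow> high_left M K n l x r \<Longrightarrow>
    \<exists>i. real M / real K \<le> markov_lambda a i"
proof (induction n arbitrary: j l x r)
  case 0
  then show ?case
    by (intro exI[of _ j] lambda_ge_sound[OF a _ _ K, of j l x r M]) auto
next
  case (Suc n)
  then show ?case by (cases l) (auto simp: window_left)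
qed

text \<open>A certificate that no ternary sequence with digit 3 at index 0 around the given window has
  $N/K < \lambda_0$ and all $\lambda_i < M/K$, except for those passing through a core.\<close>

datatype cert =
    Low
  | HighL nat
  | HighR nat
  | Core
  | SplitL cert cert cert
  | SplitR cert cert cert

fun check :: "nat \<Rightarrow> nat \<Rightarrow> nat \<Rightarrow> (nat list \<times> nat list) list \<Rightarrow>
    cert \<Rightarrow> nat list \<Rightarrow> nat list \<Rightarrow> bool" where
  "check N M K cs Low l r = lambda_le N K l 3 r"
| "check N M K cs (HighL n) l r = high_left M K n l 3 r"
| "check N M K cs (HighR n) l r = high_right M K n l 3 r"
| "check N M K cs Core l r = list_ex (\<lambda>(cl, cr). prefix cl l \<and> prefix cr r) cs"
| "check N M K cs (SplitL c1 c2 c3) l r =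
     (check N M K cs c1 (l @ [1]) r \<and> check N M K cs c2 (l @ [2]) r \<and>
      check N M K cs c3 (l @ [3]) r)"
| "check N M K cs (SplitR c1 c2 c3) l r =
     (check N M K cs c1 l (r @ [1]) \<and> check N M K cs c2 l (r @ [2]) \<and>
      check N M K cs c3 l (r @ [3]))"

lemma window_prefix:
  "window a j l x r \<Longrightarrow> prefix cl l \<Longrightarrow> prefix cr r \<Longrightarrow> window a j cl x cr"
  by (auto simp: window_def prefix_def starts_append)

lemma check_sound:
  assumes a: "ternary2 a" and K: "0 < K"
    and low: "real N / real K < markov_lambda a 0"
    and high: "\<And>i. markov_lambda a i < real M / real K"
    and core: "\<And>cl cr. (cl, cr) \<in> set cs \<Longrightarrow> \<not> window a 0 cl 3 cr"
  shows "check N M K cs c l r \<Longrightarrow> \<not> window a 0 l 3 r"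
proof (induction c arbitrary: l r)
  case Low
  then show ?case using lambda_le_sound[OF a _ _ K, of 0 l 3 r N] low by auto
next
  case (HighL n)
  then show ?case
    using high_left_sound[OF a K, of 0 l 3 r M n] high by (auto simp: not_le[symmetric])
next
  case (HighR n)
  then show ?case
    using high_right_sound[OF a K, of 0 l 3 r M n] high by (auto simp: not_le[symmetric])
next
  case Core
  then show ?case using core window_prefix[of a 0 l 3 r] by (auto simp: list_ex_iff)
next
  case (SplitL c1 c2 c3)
  have "a (- 1 - int (length l)) \<in> {1, 2, 3}"
    using a by (simp add: ternary2_def)
  then have "window a 0 l 3 r \<Longrightarrow>
      window a 0 (l @ [1]) 3 r \<or> window a 0 (l @ [2]) 3 r \<or> window a 0 (l @ [3]) 3 r"
    by (auto simp: window_def starts_append)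
  then show ?case using SplitL by auto
next
  case (SplitR c1 c2 c3)
  have "a (1 + int (length r)) \<in> {1, 2, 3}"
    using a by (simp add: ternary2_def)
  then have "window a 0 l 3 r \<Longrightarrow>
      window a 0 l 3 (r @ [1]) \<or> window a 0 l 3 (r @ [2]) \<or> window a 0 l 3 (r @ [3])"
    by (auto simp: window_def starts_append)
  then show ?case using SplitR by auto
qed

section \<open>Extremal tails\<close>

lemma starts_iff_nth: "starts b w \<longleftrightarrow> (\<forall>i<length w. b i = w ! i)"
  by (induction w arbitrary: b) (auto simp: nth_Cons less_Suc_eq_0_disj split: nat.splits)

lemma ternary_starts_set:
  assumes "ternary b" "starts b w"
  shows "set w \<subseteq> {1, 2, 3}"
proof
  fix x assume "x \<in> set w"
  then obtain i where "i < length w" "w ! i = x" by (auto simp: in_set_conv_nth)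
  then have "b i = x" using assms(2) by (simp add: starts_iff_nth)
  then show "x \<in> {1, 2, 3}" using assms(1)[unfolded ternary_def, rule_format, of i] by simp
qed

lemma eventually_periodic_unroll:
  assumes "q \<noteq> []"
  shows "eventually_periodic v q = eventually_periodic (v @ q) q"
proof
  fix k
  consider "k < length v" | "length v \<le> k" "k < length v + length q"
    | "length v + length q \<le> k" by linarith
  then show "eventually_periodic v q k = eventually_periodic (v @ q) q k"
  proof cases
    case 3
    then have "(k - length v) mod length q = (k - (length v + length q)) mod length q"
      using le_mod_geq[of "length q" "k - length v"] by simp
    then show ?thesis using 3 by (simp add: eventually_periodic_def)
  qed (auto simp: eventually_periodic_def nth_append)
qed

text \<open>Used for the left side of \<open>mu2_seq\<close>: read outwards its period is 1, 2,
  whereas \<open>extremal_21\<close> treats a period beginning with 2.\<close>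

lemma eventually_periodic_rotate:
  "eventually_periodic v (x # q) = eventually_periodic (v @ [x]) (q @ [x])"
proof
  fix k
  consider "k < length v" | "k = length v" | m where "k = length v + 1 + m"
    by (metis add.commute add_Suc_right le_Suc_ex less_or_eq_imp_le linorder_neqE_nat plus_1_eq_Suc Suc_leI)
  then show "eventually_periodic v (x # q) k = eventually_periodic (v @ [x]) (q @ [x]) k"
  proof cases
    case 3
    have "(x # q) ! (Suc m mod Suc (length q)) = (q @ [x]) ! (m mod Suc (length q))"
      using mod_less_divisor[of "Suc (length q)" m]
      by (auto simp: mod_Suc nth_append less_Suc_eq)
    then show ?thesis by (simp add: 3 eventually_periodic_def)
  qed (auto simp: eventually_periodic_def nth_append)
qed

lemma starts_eventually_periodic:
  assumes "q \<noteq> []"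
  shows "starts (eventually_periodic v q) (v @ concat (replicate n q))"
proof (induction n arbitrary: v)
  case (Suc n)
  then show ?case
    using eventually_periodic_unroll[OF assms, of v] Suc[of "v @ q"] by simp
qed (simp add: starts_iff_nth eventually_periodic_def)

lemma eventually_periodic_ternary:
  assumes "q \<noteq> []" "set (v @ q) \<subseteq> {1, 2, 3}"
  shows "ternary (eventually_periodic v q)"
proof -
  have "eventually_periodic v q k \<in> set (v @ q)" for k
    using assms by (auto simp: eventually_periodic_def)
  then show ?thesis using assms(2) by (auto simp: ternary_def)
qed

text \<open>The words 3231 and 213, read in either direction, force a value of at least $79/20$.\<close>

definition tame :: "(nat \<Rightarrow> nat) \<Rightarrow> bool" where
  "tame b \<longleftrightarrow> ternary b \<and> (\<forall>k. \<not> starts (\<lambda>i. b (k + i)) [3, 2, 3, 1]) \<and>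
     (\<forall>k. \<not> starts (\<lambda>i. b (k + i)) [2, 1, 3])"

text \<open>The common prefix of length n reverses the order n times; behind it, c has the larger
  digits at even offsets and the smaller ones at odd offsets, up to the first disagreement.\<close>

lemma extremal_tail:
  assumes b: "ternary b" and c: "ternary c"
    and lt: "\<And>k. k < n \<Longrightarrow> b k = c k"
    and ge: "\<And>k. (\<And>i. i < n + k \<Longrightarrow> b i = c i) \<Longrightarrow>
      if even k then b (n + k) \<le> c (n + k) else c (n + k) \<le> b (n + k)"
  shows "if even n then tail_frac c \<le> tail_frac b else tail_frac b \<le> tail_frac c"
proof -
  have *: "if even (n + k) then b k \<le> c k else c k \<le> b k" if "\<And>i. i < k \<Longrightarrow> b i = c i" for k
  proof (cases "k < n")
    case True
    then show ?thesis using lt by simp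
  next
    case False
    then show ?thesis using ge[of "k - n"] that by (auto split: if_splits)
  qed
  show ?thesis
  proof (cases "even n")
    case True
    then have "tail_frac c \<le> tail_frac b"
      using * by (intro tail_frac_le_if_digitwise) (auto simp: ternary_pos b c)
    then show ?thesis using True by simp
  next
    case False
    then have "tail_frac b \<le> tail_frac c"
      using * by (intro tail_frac_le_if_digitwise) (auto simp: ternary_pos b c)
    then show ?thesis using False by simp
  qed
qed

lemma eventually_periodic_2:
  "eventually_periodic v [x, y] (length v + k) = (if even k then x else y)"
  by (cases "even k") (simp_all add: eventually_periodic_def mod_2_eq_odd numeral_2_eq_2[symmetric])

text \<open>At even offsets 3 is the largest digit. At odd offsets from 3 on, a 1 would complete
  3231, so 2 is the smallest digit possible. The first 2 has no such protection and therefore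
  belongs to the assumed prefix.\<close>

lemma extremal_32:
  assumes b: "tame b" and st: "starts b (v @ [3, 2])"
  shows "if even (length v) then tail_frac (eventually_periodic v [3, 2]) \<le> tail_frac b
    else tail_frac b \<le> tail_frac (eventually_periodic v [3, 2])"
proof (rule extremal_tail)
  let ?c = "eventually_periodic v [3, 2]" and ?n = "length v"
  show tb: "ternary b" using b by (simp add: tame_def)
  have "set v \<subseteq> {1, 2, 3}" using ternary_starts_set[OF tb st] by simp
  then show "ternary ?c" by (intro eventually_periodic_ternary) auto
  have eq: "b k = ?c k" if "k < ?n + 2" for k
  proof -
    have "starts ?c (v @ [3, 2])" using starts_eventually_periodic[of "[3, 2]" v 1] by simp
    then show ?thesis using st that by (simp add: starts_iff_nth)
  qed
  then show "b k = ?c k" if "k < ?n" for k using that by simp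
  fix k assume le: "\<And>i. i < ?n + k \<Longrightarrow> b i = ?c i"
  show "if even k then b (?n + k) \<le> ?c (?n + k) else ?c (?n + k) \<le> b (?n + k)"
  proof (cases "even k")
    case True
    then show ?thesis using ternary_le[OF tb] by (simp add: eventually_periodic_2)
  next
    case odd: False
    show ?thesis
    proof (cases "k = 1")
      case True
      then show ?thesis using eq[of "?n + k"] by simp
    next
      case False
      from odd obtain i where "k = 2 * i + 1" by (rule oddE)
      then have m: "k = 2 * (i - 1) + 3" "even (2 * (i - 1))" using False by auto
      define m where "m = 2 * (i - 1)"
      note m = m[folded m_def]
      have "b (?n + m) = 3" "b (?n + m + 1) = 2" "b (?n + m + 2) = 3"
        using le[of "?n + m"] le[of "?n + (m + 1)"] le[of "?n + (m + 2)"] m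
          eventually_periodic_2[of v 3 2 m] eventually_periodic_2[of v 3 2 "m + 1"]
          eventually_periodic_2[of v 3 2 "m + 2"]
        by (simp_all add: add.assoc)
      moreover have "\<not> starts (\<lambda>i. b (?n + m + i)) [3, 2, 3, 1]" using b by (simp add: tame_def)
      ultimately have "b (?n + k) \<noteq> 1" by (simp add: m numeral_3_eq_3 numeral_2_eq_2)
      then have "2 \<le> b (?n + k)" using ternary_pos[OF tb, of "?n + k"] by linarith
      then show ?thesis using odd eventually_periodic_2[of v 3 2 k] by simp
    qed
  qed
qed

text \<open>At odd offsets 1 is the smallest digit. At positive even offsets a 3 would complete 213,
  so 2 is the largest digit possible. The first 2 has to be assumed.\<close>

lemma extremal_21:
  assumes b: "tame b" and st: "starts b (v @ [2])"
  shows "if even (length v) then tail_frac (eventually_periodic v [2, 1]) \<le> tail_frac b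
    else tail_frac b \<le> tail_frac (eventually_periodic v [2, 1])"
proof (rule extremal_tail)
  let ?c = "eventually_periodic v [2, 1]" and ?n = "length v"
  show tb: "ternary b" using b by (simp add: tame_def)
  have "set v \<subseteq> {1, 2, 3}" using ternary_starts_set[OF tb st] by simp
  then show "ternary ?c" by (intro eventually_periodic_ternary) auto
  have eq: "b k = ?c k" if "k < ?n + 1" for k
  proof -
    have "starts ?c (v @ [2])"
      using starts_eventually_periodic[of "[2, 1]" v 1] by (simp add: starts_append)
    then show ?thesis using st that by (simp add: starts_iff_nth)
  qed
  then show "b k = ?c k" if "k < ?n" for k using that by simp
  fix k assume le: "\<And>i. i < ?n + k \<Longrightarrow> b i = ?c i"
  show "if even k then b (?n + k) \<le> ?c (?n + k) else ?c (?n + k) \<le> b (?n + k)"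
  proof (cases "odd k")
    case True
    then show ?thesis
      using ternary_pos[OF tb, of "?n + k"] by (simp add: eventually_periodic_2)
  next
    case even: False
    show ?thesis
    proof (cases "k = 0")
      case True
      then show ?thesis using eq[of "?n + k"] by simp
    next
      case False
      from even obtain i where "k = 2 * i" by auto
      then have m: "k = 2 * (i - 1) + 2" "even (2 * (i - 1))" using False by auto
      define m where "m = 2 * (i - 1)"
      note m = m[folded m_def]
      have "b (?n + m) = 2" "b (?n + m + 1) = 1"
        using le[of "?n + m"] le[of "?n + (m + 1)"] m
          eventually_periodic_2[of v 2 1 m] eventually_periodic_2[of v 2 1 "m + 1"]
        by (simp_all add: add.assoc)
      moreover have "\<not> starts (\<lambda>i. b (?n + m + i)) [2, 1, 3]" using b by (simp add: tame_def)
      ultimately have "b (?n + k) \<noteq> 3" by (simp add: m numeral_3_eq_3 numeral_2_eq_2)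
      then have "b (?n + k) \<le> 2" using ternary_le[OF tb, of "?n + k"] by linarith
      then show ?thesis using even eventually_periodic_2[of v 2 1 k] by simp
    qed
  qed
qed

text \<open>Prepending a digit y \<ge> 1 divides a difference by a product of two factors that
  exceed 1. The crude constant 1 is enough, because in \<open>mu1_core\<close> the deviations of two
  short sides are merely compared with each other.\<close>

lemma tail_frac_lipschitz:
  assumes "ternary b" "ternary c" "starts b w" "starts c w"
  shows "\<bar>tail_frac b - tail_frac c\<bar> \<le>
    \<bar>tail_frac (\<lambda>k. b (length w + k)) - tail_frac (\<lambda>k. c (length w + k))\<bar>"
  using assms
proof (induction w arbitrary: b c)
  case (Cons y w)
  let ?b = "tail_frac (\<lambda>k. b (Suc k))" and ?c = "tail_frac (\<lambda>k. c (Suc k))"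
  have pos: "0 < ?b" "0 < ?c" using Cons.prems ternary_pos by (auto intro!: tail_frac_pos)
  have y: "1 \<le> real y" using ternary_pos[OF Cons.prems(1), of 0] Cons.prems(3) by simp
  have "tail_frac b = 1 / (y + ?b)" "tail_frac c = 1 / (y + ?c)"
    using ternary_unfold[OF Cons.prems(1)] ternary_unfold[OF Cons.prems(2)] Cons.prems(3,4) by simp_all
  then have "tail_frac b - tail_frac c = (?c - ?b) / ((y + ?b) * (y + ?c))"
    using pos y by (simp add: diff_frac_eq)
  moreover have "1 * 1 \<le> (y + ?b) * (y + ?c)" using pos y by (intro mult_mono) auto
  ultimately have "\<bar>tail_frac b - tail_frac c\<bar> \<le> \<bar>?b - ?c\<bar> / 1"
    using pos y by (simp add: abs_mult abs_minus_commute[of ?c] del: div_by_1) (intro divide_left_mono, auto)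
  also have "\<bar>?b - ?c\<bar> \<le> \<bar>tail_frac (\<lambda>k. b (Suc (length w + k))) -
      tail_frac (\<lambda>k. c (Suc (length w + k)))\<bar>"
    using Cons.IH[of "\<lambda>k. b (Suc k)" "\<lambda>k. c (Suc k)"] Cons.prems ternary_Suc by simp
  finally show ?case by simp
qed simp

section \<open>Admissible sequences\<close>

text \<open>The threshold 79/20 lies above all four Markov values, yet is low enough to exclude the
  two words in \<open>tame\<close>.\<close>

definition admissible :: "(int \<Rightarrow> nat) \<Rightarrow> bool" where
  "admissible a \<longleftrightarrow> ternary2 a \<and> (\<forall>i. markov_lambda a i < 79 / 20)"

lemma markov_lambda_reflect:
  assumes "ternary2 a"
  shows "markov_lambda (\<lambda>i. a (- i)) j = markov_lambda a (- j)"
  using markov_lambda_eq[of a] markov_lambda_eq[of "\<lambda>i. a (- i)"] ternary2_pos[OF assms]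
  by (simp add: algebra_simps)

lemma ternary2_reflect: "ternary2 a \<Longrightarrow> ternary2 (\<lambda>i. a (- i))"
  by (simp add: ternary2_def)

lemma admissible_reflect: "admissible a \<Longrightarrow> admissible (\<lambda>i. a (- i))"
  by (simp add: admissible_def markov_lambda_reflect ternary2_reflect)

lemma window_reflect: "window (\<lambda>i. a (- i)) j l x r \<longleftrightarrow> window a (- j) r x l"
proof -
  have "- (j + 1 + int k) = - j - 1 - int k" "- (j - 1 - int k) = - j + 1 + int k" for k
    by simp_all
  then show ?thesis by (simp only: window_def) blast
qed

lemma markov_lambda_shift: "markov_lambda (\<lambda>i. a (j + i)) i = markov_lambda a (j + i)"
proof -
  have "j + i + int k = j + (i + int k)" "j + i - int k = j + (i - int k)" for k
    by simp_all
  then show ?thesis by (simp only: markov_lambda_def)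
qed

text \<open>The large value occurs at the second 3 of 3231 and at the 3 of 213; the known neighbours
  already push it to 79/20 whatever follows.\<close>

lemma admissible_tame_right:
  assumes "admissible a"
  shows "tame (\<lambda>k. a (j + int k))"
  unfolding tame_def
proof (intro conjI allI notI)
  have a: "ternary2 a" and lt: "markov_lambda a i < 79 / 20" for i
    using assms by (auto simp: admissible_def)
  show "ternary (\<lambda>k. a (j + int k))" by (rule ternary2_halves(1)[OF a])
  have no: False if "window a i l x r" "lambda_ge 79 20 l x r" for i l x r
    using lambda_ge_sound[OF a that, of] lt[of i] by simp
  fix k
  show False if "starts (\<lambda>i. a (j + int (k + i))) [3, 2, 3, 1]"
  proof (rule no)
    show "window a (j + int k + 2) [2, 3] 3 [1]"
      using that by (simp add: window_def algebra_simps)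
    show "lambda_ge 79 20 [2, 3] 3 [1]" by code_simp
  qed
  show False if "starts (\<lambda>i. a (j + int (k + i))) [2, 1, 3]"
  proof (rule no)
    show "window a (j + int k + 2) [1, 2] 3 []"
      using that by (simp add: window_def algebra_simps)
    show "lambda_ge 79 20 [1, 2] 3 []" by code_simp
  qed
qed

lemma admissible_tame_left:
  assumes "admissible a"
  shows "tame (\<lambda>k. a (j - int k))"
  using admissible_tame_right[OF admissible_reflect[OF assms], of "- j"] by simp

lemma markov_lambda_window:
  assumes "ternary2 a" "window a j l x r"
  shows "markov_lambda a j = real x + tail_frac (\<lambda>k. a (j + 1 + int k)) +
    tail_frac (\<lambda>k. a (j - 1 - int k))"
  using markov_lambda_eq[of a j] ternary2_pos[OF assms(1)] assms(2) by (simp add: window_def)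

section \<open>Eventually periodic bi-infinite words\<close>

lemma marked_seq_halves:
  "marked_seq p u c v q 0 = c"
  "(\<lambda>k. marked_seq p u c v q (1 + int k)) = eventually_periodic v q"
  "(\<lambda>k. marked_seq p u c v q (- 1 - int k)) = eventually_periodic (rev u) (rev p)"
  by (auto simp: marked_seq_def fun_eq_iff nat_diff_distrib')

lemma marked_seq_reflect:
  "(\<lambda>i. marked_seq p u c v q (- i)) = marked_seq (rev q) (rev v) c (rev u) (rev p)"
  by (auto simp: marked_seq_def fun_eq_iff)

lemma marked_seq_ternary2:
  assumes "p \<noteq> []" "q \<noteq> []" "set (p @ u @ c # v @ q) \<subseteq> {1, 2, 3}"
  shows "ternary2 (marked_seq p u c v q)"
proof -
  have "ternary (eventually_periodic v q)" "ternary (eventually_periodic (rev u) (rev p))"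
    using assms by (auto intro!: eventually_periodic_ternary)
  then show ?thesis
    using assms(3) by (auto simp: ternary2_def marked_seq_def ternary_def)
qed

lemma marked_seq_lambda_0:
  assumes "ternary2 (marked_seq p u c v q)"
  shows "markov_lambda (marked_seq p u c v q) 0 = real c + tail_frac (eventually_periodic v q) +
    tail_frac (eventually_periodic (rev u) (rev p))"
  using markov_lambda_eq[of "marked_seq p u c v q" 0] ternary2_pos[OF assms]
  by (simp add: marked_seq_halves)

lemma marked_seq_window:
  assumes "p \<noteq> []" "q \<noteq> []"
  shows "window (marked_seq p u c v q) 0 (rev u @ concat (replicate m (rev p))) c
    (v @ concat (replicate n q))"
  using starts_eventually_periodic[of q v n] starts_eventually_periodic[of "rev p" "rev u" m] assms
  by (simp add: window_def marked_seq_halves)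

text \<open>Entry i of the flag list belongs to the place i + 1 steps to the right. The flag
  \<open>True\<close> exempts a place whose value ties with that at the mark and so escapes
  numerical estimates.\<close>

fun sweep :: "nat \<Rightarrow> nat \<Rightarrow> bool list \<Rightarrow> nat list \<Rightarrow> nat \<Rightarrow> nat list \<Rightarrow> bool" where
  "sweep N K [] l x r = True"
| "sweep N K (b # bs) l x r =
     (case r of [] \<Rightarrow> False
      | y # r' \<Rightarrow> (b \<or> lambda_le N K (x # l) y r') \<and> sweep N K bs (x # l) y r')"

lemma sweep_sound:
  assumes a: "ternary2 a" and K: "0 < K"
  shows "window a j l x r \<Longrightarrow> sweep N K bs l x r \<Longrightarrow> i < length bs \<Longrightarrow> \<not> bs ! i \<Longrightarrow>
    markov_lambda a (j + 1 + int i) \<le> real N / real K"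
proof (induction bs arbitrary: j l x r i)
  case (Cons b bs)
  from Cons.prems obtain y r' where r: "r = y # r'" by (cases r) auto
  have w: "window a (j + 1) (x # l) y r'" using Cons.prems(1) by (simp add: r window_right)
  show ?case
  proof (cases i)
    case 0
    then show ?thesis using Cons.prems lambda_le_sound[OF a w _ K] by (auto simp: r)
  next
    case (Suc i')
    then show ?thesis using Cons.IH[OF w, of i'] Cons.prems by (simp add: r algebra_simps)
  qed
qed simp

text \<open>The first periodic digit has index \<open>length v + 1\<close>, so from
  \<open>length v + 2\<close> on the left neighbour is periodic as well. Then the digit itself is 2
  or both its neighbours are 2, and either case keeps the value below 39/10.\<close>

lemma marked_seq_far:
  assumes a: "ternary2 (marked_seq p u c v [x, y])" and 2: "x = 2 \<or> y = 2"
    and j: "int (length v) + 2 \<le> j"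
  shows "markov_lambda (marked_seq p u c v [x, y]) j \<le> 39 / 10"
proof -
  let ?a = "marked_seq p u c v [x, y]"
  define m where "m = nat (j - 2) - length v"
  have m: "j = int (length v + m) + 2" using j by (simp add: m_def)
  have eq: "?a (1 + int (length v + i)) = (if even i then x else y)" for i
    using fun_cong[OF marked_seq_halves(2)] eventually_periodic_2 by metis
  have s: "?a (j - 1) = (if even m then x else y)" "?a j = (if even m then y else x)"
      "?a (j + 1) = (if even m then x else y)"
    using eq[of m] eq[of "m + 1"] eq[of "m + 2"] by (simp_all add: m algebra_simps)
  have le: "markov_lambda ?a j \<le> 39 / 10" if "window ?a j l z r" "lambda_le 39 10 l z r" for l z r
    using lambda_le_sound[OF a that] by simp
  show ?thesis
  proof (cases "?a j = 2")
    case True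
    moreover have "lambda_le 39 10 [] 2 []" by code_simp
    ultimately show ?thesis by (intro le[of "[]" 2 "[]"]) (auto simp: window_def)
  next
    case False
    then have "?a (j - 1) = 2" "?a (j + 1) = 2" using s 2 by (auto split: if_splits)
    then have w: "window ?a j [2] (?a j) [2]" by (simp add: window_def)
    have "?a j \<in> {1, 2, 3}" using a by (simp add: ternary2_def)
    moreover have "lambda_le 39 10 [2] 1 [2]" "lambda_le 39 10 [2] 2 [2]" "lambda_le 39 10 [2] 3 [2]"
      by code_simp+
    ultimately show ?thesis by (intro le[OF w]) auto
  qed
qed


lemma marked_seq_lambda_right:
  assumes a: "ternary2 (marked_seq p u c v [x, y])" and p: "p \<noteq> []" and 2: "x = 2 \<or> y = 2"
    and K: "0 < K" "39 * K \<le> 10 * N"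
    and sw: "sweep N K bs (rev u @ concat (replicate m (rev p))) c (v @ concat (replicate n [x, y]))"
    and len: "length bs = length v + 1"
    and j: "0 < j" "j \<le> int (length v) + 1 \<Longrightarrow> \<not> bs ! nat (j - 1)"
  shows "markov_lambda (marked_seq p u c v [x, y]) j \<le> real N / real K"
proof (cases "j \<le> int (length v) + 1")
  case True
  have "markov_lambda (marked_seq p u c v [x, y]) (0 + 1 + int (nat (j - 1))) \<le> real N / real K"
  proof (rule sweep_sound[OF a K(1) marked_seq_window sw])
    show "nat (j - 1) < length bs" using True len j(1) by simp
    show "\<not> bs ! nat (j - 1)" using j(2) True by blast
  qed (simp_all add: p)
  then show ?thesis using j(1) by simp
next
  case False
  have "39 * real K \<le> 10 * real N" using K(2) by linarith
  then have "39 / 10 \<le> real N / real K" using K(1) by (simp add: field_simps)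
  moreover have "markov_lambda (marked_seq p u c v [x, y]) j \<le> 39 / 10"
    using marked_seq_far[OF a 2, of j] False by simp
  ultimately show ?thesis by linarith
qed

lemma marked_seq_lambda_left:
  assumes a: "ternary2 (marked_seq [y, x] u c v q)" and q: "q \<noteq> []" and 2: "x = 2 \<or> y = 2"
    and K: "0 < K" "39 * K \<le> 10 * N"
    and sw: "sweep N K bs (v @ concat (replicate n q)) c (rev u @ concat (replicate m [x, y]))"
    and len: "length bs = length u + 1"
    and j: "j < 0" "- j \<le> int (length u) + 1 \<Longrightarrow> \<not> bs ! nat (- j - 1)"
  shows "markov_lambda (marked_seq [y, x] u c v q) j \<le> real N / real K"
proof -
  have eq: "(\<lambda>i. marked_seq [y, x] u c v q (- i)) = marked_seq (rev q) (rev v) c (rev u) [x, y]"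
    using marked_seq_reflect[of "[y, x]" u c v q] by simp
  have "markov_lambda (marked_seq (rev q) (rev v) c (rev u) [x, y]) (- j) \<le> real N / real K"
  proof (rule marked_seq_lambda_right[OF _ _ 2 K])
    show "ternary2 (marked_seq (rev q) (rev v) c (rev u) [x, y])"
      using ternary2_reflect[OF a] unfolding eq .
    show "sweep N K bs (rev (rev v) @ concat (replicate n (rev (rev q)))) c
        (rev u @ concat (replicate m [x, y]))"
      using sw by simp
    show "rev q \<noteq> []" using q by simp
    show "length bs = length (rev u) + 1" using len by simp
    show "0 < - j" using j(1) by simp
    show "\<not> bs ! nat (- j - 1)" if "- j \<le> int (length (rev u)) + 1"
      using j(2) that by simp
  qed
  then show ?thesis using markov_lambda_reflect[OF a, of "- j"] unfolding eq by simp
qed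

lemma attained_at_markI:
  assumes "\<And>j. markov_lambda a j \<le> markov_lambda a 0"
  shows "attained_at_mark a"
proof -
  have "bdd_above (range (markov_lambda a))" using assms by (intro bdd_aboveI2)
  moreover from this have "markov_value a = markov_lambda a 0"
    unfolding markov_value_def using assms by (intro antisym cSUP_least cSUP_upper) auto
  ultimately show ?thesis by (simp add: attained_at_mark_def)
qed

lemma attained_in_spectrum:
  assumes "attained_at_mark a" "ternary2 a"
  shows "markov_value a \<in> markov_spectrum"
  using assms(1) ternary2_pos[OF assms(2)] unfolding attained_at_mark_def markov_spectrum_def
  by (intro CollectI exI[of _ a]) simp

section \<open>Gaps\<close>

text \<open>The supremum may fail to be attained, but some \<lambda>_j exceeds \<nu> and all
  \<lambda>_i stay below \<mu>. Shifting j to index 0 yields exactly the situation that the tree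
  refutes.\<close>

lemma spectrum_gapI:
  assumes K: "0 < K" and low: "real N / real K \<le> \<nu>" and high: "\<mu> \<le> real M / real K"
    and num: "18 * K \<le> 5 * N" "\<mu> \<le> 79 / 20"
    and core: "\<And>a cl cr. admissible a \<Longrightarrow> (\<And>i. markov_lambda a i < \<mu>) \<Longrightarrow>
      \<nu> < markov_lambda a 0 \<Longrightarrow> (cl, cr) \<in> set cs \<Longrightarrow> \<not> window a 0 cl 3 cr"
    and check: "check N M K cs t [] []"
  shows "{\<nu><..<\<mu>} \<inter> markov_spectrum = {}"
proof (rule ccontr)
  assume "{\<nu><..<\<mu>} \<inter> markov_spectrum \<noteq> {}"
  then obtain s where "s \<in> markov_spectrum" "\<nu> < s" "s < \<mu>" by auto
  then obtain a where pos: "\<And>j. 0 < a j" and bdd: "bdd_above (range (markov_lambda a))"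
    and gap: "\<nu> < markov_value a" "markov_value a < \<mu>"
    unfolding markov_spectrum_def mem_Collect_eq by metis
  have lt: "markov_lambda a i < \<mu>" for i
    using cSUP_upper[OF UNIV_I bdd, of i] gap(2) by (simp add: markov_value_def)
  obtain j where j: "\<nu> < markov_lambda a j"
    using gap(1) bdd by (auto simp: markov_value_def less_cSUP_iff)
  define b where "b = (\<lambda>i. a (j + i))"
  have b_lt: "markov_lambda b i < \<mu>" for i
    by (simp add: b_def markov_lambda_shift lt)
  have b_gt: "\<nu> < markov_lambda b 0"
    using j by (simp add: b_def markov_lambda_shift)
  have b: "ternary2 b"
    unfolding ternary2_def
  proof
    fix i
    have bp: "0 < b i" for i using pos by (simp add: b_def)
    have "real (b i) \<le> markov_lambda b i"
      using markov_lambda_eq[of b i] bp tail_frac_pos[of "\<lambda>k. b (i + 1 + int k)"]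
        tail_frac_pos[of "\<lambda>k. b (i - 1 - int k)"] by simp
    then have "real (b i) < 4" using b_lt[of i] num(2) by linarith
    then show "b i \<in> {1, 2, 3}" using bp[of i] by auto
  qed
  have adm: "admissible b"
    using b less_le_trans[OF b_lt num(2)] by (simp add: admissible_def)
  have b_gt': "real N / real K < markov_lambda b 0" using b_gt low by linarith
  have "b 0 = 3"
  proof (rule ccontr)
    assume "b 0 \<noteq> 3"
    moreover have "b 0 \<in> {1, 2, 3}" using b by (simp add: ternary2_def)
    \<comment> \<open>With a central digit at most 2 the value is at most 2 + 2 * 19/24 = 43/12,
      which is less than 18/5.\<close>
    moreover have "lambda_le 18 5 [] 1 []" "lambda_le 18 5 [] 2 []" by code_simp+
    ultimately have "markov_lambda b 0 \<le> real 18 / real 5"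
      by (intro lambda_le_sound[OF b, of 0 "[]" "b 0" "[]"]) (auto simp: window_def)
    moreover have "18 * real K \<le> 5 * real N" using num(1) by linarith
    then have "18 / 5 \<le> real N / real K" using K by (simp add: field_simps)
    ultimately show False using b_gt' by simp
  qed
  then have "window b 0 [] 3 []" by (simp add: window_def)
  moreover have "\<not> window b 0 [] 3 []"
  proof (rule check_sound[OF b K b_gt' _ _ check])
    show "markov_lambda b i < real M / real K" for i using b_lt[of i] high by linarith
    show "\<not> window b 0 cl 3 cr" if "(cl, cr) \<in> set cs" for cl cr
      using core[OF adm b_lt b_gt that] .
  qed
  ultimately show False by simp
qed

section \<open>The four sequences\<close>

lemmas seq_defs = nu1_seq_def mu1_seq_def nu2_seq_def mu2_seq_def

lemma ternary2_seqs: "ternary2 nu1_seq" "ternary2 mu1_seq" "ternary2 nu2_seq" "ternary2 mu2_seq"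
  unfolding seq_defs by (intro marked_seq_ternary2; simp)+

text \<open>The sequence of $\mu_1$ is
  $\overline{23}$ \<open>rev arm\<close> $3^*$ \<open>bridge\<close> $3$ \<open>arm\<close> $\overline{32}$, with a palindrome
  \<open>bridge\<close>. The cores extend just far enough into the periodic parts that any other continuation
  changes $\lambda_0$ in a known direction or contains a forbidden word.\<close>

definition arm :: "nat list" where
  "arm = [3, 3, 1, 1, 3, 2, 1, 2, 3, 1, 1, 3, 3, 1, 1, 1, 3, 3]"
definition bridge :: "nat list" where
  "bridge = [1, 1, 1, 3, 3, 1, 1, 1]"

definition core_l_nu1 :: "nat list" where "core_l_nu1 = [1, 1, 1, 3, 3] @ [3, 2]"
definition core_r_nu1 :: "nat list" where "core_r_nu1 = [3] @ [3, 2]"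

definition core_l_mu1 :: "nat list" where "core_l_mu1 = arm @ [3, 2]"
definition core_r_mu1 :: "nat list" where "core_r_mu1 = (bridge @ [3] @ arm) @ [3, 2]"

definition core_l_nu2 :: "nat list" where
  "core_l_nu2 = [1, 1, 1, 3, 3, 1, 1, 1, 3, 3, 1, 1, 1, 3, 3, 3, 1, 1, 3] @ [2]"
definition core_r_nu2 :: "nat list" where "core_r_nu2 = [3, 3, 1, 1, 3] @ [2]"

definition core_l_mu2 :: "nat list" where "core_l_mu2 = [1, 1, 1, 3, 3, 1, 1, 1] @ [2]"
definition core_r_mu2 :: "nat list" where "core_r_mu2 = arm @ [3, 2]"

text \<open>Each core is listed with its sides exchanged too, as the tree does not fix an
  orientation.\<close>

definition cores1 :: "(nat list \<times> nat list) list" where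
  "cores1 = [(core_l_nu1, core_r_nu1), (core_r_nu1, core_l_nu1),
     (core_l_mu1, core_r_mu1), (core_r_mu1, core_l_mu1)]"

definition cores2 :: "(nat list \<times> nat list) list" where
  "cores2 = [(core_l_nu2, core_r_nu2), (core_r_nu2, core_l_nu2),
     (core_l_mu2, core_r_mu2), (core_r_mu2, core_l_mu2)]"

section \<open>Extremality behind the cores\<close>

lemma nu1_core:
  assumes a: "admissible a" and w: "window a j core_l_nu1 3 core_r_nu1"
  shows "markov_lambda a j \<le> markov_lambda nu1_seq 0"
proof -
  \<comment> \<open>The prefixes have odd lengths 1 and 5, so the periodic tails maximise both
    sides.\<close>
  have "tail_frac (\<lambda>k. a (j + 1 + int k)) \<le> tail_frac (eventually_periodic [3] [3, 2])"
    using extremal_32[OF admissible_tame_right[OF a], of "j + 1" "[3]"] w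
    by (simp add: window_def core_r_nu1_def)
  moreover have "tail_frac (\<lambda>k. a (j - 1 - int k)) \<le>
      tail_frac (eventually_periodic [1, 1, 1, 3, 3] [3, 2])"
    using extremal_32[OF admissible_tame_left[OF a], of "j - 1" "[1, 1, 1, 3, 3]"] w
    by (simp add: window_def core_l_nu1_def)
  moreover have "markov_lambda nu1_seq 0 = 3 + tail_frac (eventually_periodic [3] [3, 2]) +
      tail_frac (eventually_periodic [1, 1, 1, 3, 3] [3, 2])"
    using marked_seq_lambda_0 ternary2_seqs(1) unfolding nu1_seq_def by simp
  ultimately show ?thesis
    using markov_lambda_window[OF _ w] a by (simp add: admissible_def)
qed

lemma nu2_core:
  assumes a: "admissible a" and w: "window a j core_l_nu2 3 core_r_nu2"
  shows "markov_lambda a j \<le> markov_lambda nu2_seq 0"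
proof -
  let ?l = "[1, 1, 1, 3, 3, 1, 1, 1, 3, 3, 1, 1, 1, 3, 3, 3, 1, 1, 3] :: nat list"
  \<comment> \<open>Here the prefixes have the odd lengths 5 and 19.\<close>
  have "tail_frac (\<lambda>k. a (j + 1 + int k)) \<le>
      tail_frac (eventually_periodic [3, 3, 1, 1, 3] [2, 1])"
    using extremal_21[OF admissible_tame_right[OF a], of "j + 1" "[3, 3, 1, 1, 3]"] w
    by (simp add: window_def core_r_nu2_def)
  moreover have "tail_frac (\<lambda>k. a (j - 1 - int k)) \<le> tail_frac (eventually_periodic ?l [2, 1])"
    using extremal_21[OF admissible_tame_left[OF a], of "j - 1" ?l] w
    by (simp add: window_def core_l_nu2_def)
  moreover have "markov_lambda nu2_seq 0 = 3 +
      tail_frac (eventually_periodic [3, 3, 1, 1, 3] [2, 1]) +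
      tail_frac (eventually_periodic ?l [2, 1])"
    using marked_seq_lambda_0 ternary2_seqs(3) unfolding nu2_seq_def by simp
  ultimately show ?thesis
    using markov_lambda_window[OF _ w] a by (simp add: admissible_def)
qed

lemma mu2_core:
  assumes a: "admissible a" and w: "window a j core_l_mu2 3 core_r_mu2"
  shows "markov_lambda mu2_seq 0 \<le> markov_lambda a j"
proof -
  let ?l = "[1, 1, 1, 3, 3, 1, 1, 1] :: nat list"
  \<comment> \<open>Both prefixes, of lengths 18 and 8, are even, so the periodic tails minimise
    both sides.\<close>
  have "tail_frac (eventually_periodic arm [3, 2]) \<le> tail_frac (\<lambda>k. a (j + 1 + int k))"
    using extremal_32[OF admissible_tame_right[OF a], of "j + 1" arm] w
    by (simp add: window_def core_r_mu2_def arm_def)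
  moreover have "tail_frac (eventually_periodic ?l [2, 1]) \<le> tail_frac (\<lambda>k. a (j - 1 - int k))"
    using extremal_21[OF admissible_tame_left[OF a], of "j - 1" ?l] w
    by (simp add: window_def core_l_mu2_def)
  moreover have "markov_lambda mu2_seq 0 = 3 + tail_frac (eventually_periodic arm [3, 2]) +
      tail_frac (eventually_periodic ?l [2, 1])"
    using marked_seq_lambda_0 ternary2_seqs(4)
      eventually_periodic_rotate[of "[1, 1, 1, 3, 3, 1, 1]" 1 "[2]"]
    unfolding mu2_seq_def by (simp add: arm_def)
  ultimately show ?thesis
    using markov_lambda_window[OF _ w] a by (simp add: admissible_def)
qed

lemma mu1_lambda_0: "markov_lambda mu1_seq 0 = 3 +
    tail_frac (eventually_periodic (bridge @ [3] @ arm) [3, 2]) +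
    tail_frac (eventually_periodic arm [3, 2])"
  using marked_seq_lambda_0 ternary2_seqs(2) unfolding mu1_seq_def
  by (simp add: arm_def bridge_def)

lemma eventually_periodic_drop:
  "(\<lambda>k. eventually_periodic (v @ w) q (length v + k)) = eventually_periodic w q"
  by (auto simp: eventually_periodic_def nth_append)

lemma bridge_arm:
  "starts (eventually_periodic (bridge @ [3] @ arm) [3, 2]) (bridge @ [3])"
  "(\<lambda>k. eventually_periodic (bridge @ [3] @ arm) [3, 2] (9 + k)) = eventually_periodic arm [3, 2]"
proof -
  show "starts (eventually_periodic (bridge @ [3] @ arm) [3, 2]) (bridge @ [3])"
    using starts_eventually_periodic[of "[3, 2]" "bridge @ [3] @ arm" 0]
    by (simp add: starts_append)
  have "length (bridge @ [3]) = 9" by (simp add: bridge_def)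
  then show "(\<lambda>k. eventually_periodic (bridge @ [3] @ arm) [3, 2] (9 + k)) =
      eventually_periodic arm [3, 2]"
    using eventually_periodic_drop[of "bridge @ [3]" arm "[3, 2]"] by simp
qed

text \<open>Nine digits into the long side of \<open>mu1_seq\<close> its short side begins, so a
  deviation on a long side is controlled by one on a short side.\<close>

lemma bridge_lipschitz:
  assumes "ternary b" "starts b (bridge @ [3])"
  shows "\<bar>tail_frac b - tail_frac (eventually_periodic (bridge @ [3] @ arm) [3, 2])\<bar> \<le>
    \<bar>tail_frac (\<lambda>k. b (9 + k)) - tail_frac (eventually_periodic arm [3, 2])\<bar>"
proof -
  have len: "length (bridge @ [3]) = 9" by (simp add: bridge_def)
  have "ternary (eventually_periodic (bridge @ [3] @ arm) [3, 2])"
    by (intro eventually_periodic_ternary) (simp_all add: arm_def bridge_def)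
  from tail_frac_lipschitz[OF assms(1) this assms(2) bridge_arm(1)] show ?thesis
    unfolding len bridge_arm(2) .
qed

text \<open>On the long side of the marked digit the tail $\overline{32}$ is extremal in the wrong
  direction, so $\lambda_0$ alone may drop below $\mu_1$. The palindrome exchanges the indices 0
  and 9, and a long side contracts the deviation of the tail behind it; hence the index whose short
  side deviates more has a value of at least $\mu_1$.\<close>

lemma mu1_core:
  assumes a: "admissible a" and w: "window a 0 core_l_mu1 3 core_r_mu1"
  shows "\<exists>i. markov_lambda mu1_seq 0 \<le> markov_lambda a i"
proof -
  have a2: "ternary2 a" using a by (simp add: admissible_def)
  let ?E = "eventually_periodic arm [3, 2]"
  let ?F = "eventually_periodic (bridge @ [3] @ arm) [3, 2]"
  let ?s = "tail_frac (\<lambda>k. a (- 1 - int k))" and ?t = "tail_frac (\<lambda>k. a (10 + int k))"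
  have r: "starts (\<lambda>k. a (1 + int k)) (bridge @ [3])" "starts (\<lambda>k. a (10 + int k)) (arm @ [3, 2])"
    using w by (simp_all add: window_def core_r_mu1_def starts_append bridge_def arm_def)
  have l: "starts (\<lambda>k. a (- 1 - int k)) (arm @ [3, 2])"
    using w by (simp add: window_def core_l_mu1_def)
  have w9: "window a 9 (bridge @ [3]) 3 []"
    using w by (simp add: window_def core_r_mu1_def bridge_def arm_def)
  have st: "tail_frac ?E \<le> ?s" "tail_frac ?E \<le> ?t"
    using extremal_32[OF admissible_tame_left[OF a], of "-1" arm] l
      extremal_32[OF admissible_tame_right[OF a], of 10 arm] r(2)
    by (simp_all add: arm_def)
  have "\<bar>tail_frac (\<lambda>k. a (1 + int k)) - tail_frac ?F\<bar> \<le> \<bar>?t - tail_frac ?E\<bar>"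
    using bridge_lipschitz[OF ternary2_halves(1)[OF a2] r(1)] by (simp add: add.assoc[symmetric])
  moreover have "\<bar>tail_frac (\<lambda>k. a (8 - int k)) - tail_frac ?F\<bar> \<le> \<bar>?s - tail_frac ?E\<bar>"
    using bridge_lipschitz[OF ternary2_halves(2)[OF a2], of 8] w9
    by (simp add: window_def diff_diff_eq[symmetric])
  moreover have "markov_lambda a 0 = 3 + tail_frac (\<lambda>k. a (1 + int k)) + ?s"
    using markov_lambda_window[OF a2 w] by simp
  moreover have "markov_lambda a 9 = 3 + ?t + tail_frac (\<lambda>k. a (8 - int k))"
    using markov_lambda_window[OF a2 w9] by simp
  ultimately have "markov_lambda mu1_seq 0 \<le> markov_lambda a 0 \<or>
      markov_lambda mu1_seq 0 \<le> markov_lambda a 9"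
    using st unfolding mu1_lambda_0 by linarith
  then show ?thesis by blast
qed

text \<open>The word is invariant under i \<mapsto> 9 - i. The left tail at index 9 is identified
  with the long side through \<open>bridge_lipschitz\<close>, with deviation zero.\<close>

lemma markov_lambda_mu1_9: "markov_lambda mu1_seq 9 = markov_lambda mu1_seq 0"
proof -
  let ?F = "eventually_periodic (bridge @ [3] @ arm) [3, 2]"
  let ?E = "eventually_periodic arm [3, 2]"
  have seq: "mu1_seq = marked_seq [2, 3] (rev arm) 3 (bridge @ [3] @ arm) [3, 2]"
    by (simp add: mu1_seq_def arm_def bridge_def)
  have halves: "mu1_seq 0 = 3" "(\<lambda>k. mu1_seq (1 + int k)) = ?F" "(\<lambda>k. mu1_seq (- 1 - int k)) = ?E"
    unfolding seq marked_seq_halves by simp_all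
  have "starts (\<lambda>k. mu1_seq (1 + int k)) (bridge @ [3])" unfolding halves(2) by (rule bridge_arm(1))
  then have w9: "window mu1_seq 9 (bridge @ [3]) 3 []"
    using halves(1) by (simp add: window_def bridge_def)
  have right: "(\<lambda>k. mu1_seq (10 + int k)) = ?E"
  proof
    fix k
    show "mu1_seq (10 + int k) = ?E k"
      using fun_cong[OF halves(2), of "9 + k"] fun_cong[OF bridge_arm(2), of k] by (simp add: algebra_simps)
  qed
  have "\<bar>tail_frac (\<lambda>k. mu1_seq (8 - int k)) - tail_frac ?F\<bar> \<le> \<bar>tail_frac ?E - tail_frac ?E\<bar>"
    using bridge_lipschitz[OF ternary2_halves(2)[OF ternary2_seqs(2)], of 8] w9 halves(3)
    by (simp add: window_def diff_diff_eq[symmetric])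
  then show ?thesis
    using markov_lambda_window[OF ternary2_seqs(2) w9] right by (simp add: mu1_lambda_0)
qed

section \<open>Decimal enclosures of the four values\<close>

lemma nu1_window: "window nu1_seq 0 ([1, 1, 1, 3, 3] @ concat (replicate 20 [3, 2])) 3
    ([3] @ concat (replicate 20 [3, 2]))"
  using marked_seq_window[of "[2, 3]" "[3, 2]" "[3, 3, 1, 1, 1]" 3 "[3]" 20 20]
  by (simp add: nu1_seq_def)

lemma mu1_window: "window mu1_seq 0 (arm @ concat (replicate 20 [3, 2])) 3
    ((bridge @ [3] @ arm) @ concat (replicate 20 [3, 2]))"
  using marked_seq_window[of "[2, 3]" "[3, 2]" "rev arm" 3 "bridge @ [3] @ arm" 20 20]
  by (simp add: mu1_seq_def arm_def bridge_def)

lemma nu2_window: "window nu2_seq 0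
    ([1, 1, 1, 3, 3, 1, 1, 1, 3, 3, 1, 1, 1, 3, 3, 3, 1, 1, 3] @ concat (replicate 20 [2, 1])) 3
    ([3, 3, 1, 1, 3] @ concat (replicate 20 [2, 1]))"
  using marked_seq_window[of "[1, 2]" "[2, 1]"
      "[3, 1, 1, 3, 3, 3, 1, 1, 1, 3, 3, 1, 1, 1, 3, 3, 1, 1, 1]" 3 "[3, 3, 1, 1, 3]" 20 20]
  by (simp add: nu2_seq_def)

lemma mu2_window: "window mu2_seq 0 ([1, 1, 1, 3, 3, 1, 1] @ concat (replicate 20 [1, 2])) 3
    (arm @ concat (replicate 20 [3, 2]))"
  using marked_seq_window[of "[2, 1]" "[3, 2]" "[1, 1, 3, 3, 1, 1, 1]" 3 arm 20 20]
  by (simp add: mu2_seq_def arm_def)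

text \<open>The lower bounds of the \<nu>_i and the upper bounds of the \<mu>_i are the ones that
  enter the certificates, hence their many digits.\<close>

lemma nu1_ge: "real 394254221224894585350124 / real 100000000000000000000000 \<le> markov_lambda nu1_seq 0"
  by (rule lambda_ge_sound[OF ternary2_seqs(1) nu1_window]) code_simp+

lemma nu1_le: "markov_lambda nu1_seq 0 \<le> real 394254222 / real 100000000"
  by (rule lambda_le_sound[OF ternary2_seqs(1) nu1_window]) code_simp+

lemma mu1_ge: "real 39433046 / real 10000000 \<le> markov_lambda mu1_seq 0"
  by (rule lambda_ge_sound[OF ternary2_seqs(2) mu1_window]) code_simp+

lemma mu1_le: "markov_lambda mu1_seq 0 \<le> real 394330461351478987519153 / real 100000000000000000000000"
  by (rule lambda_le_sound[OF ternary2_seqs(2) mu1_window]) code_simp+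

lemma nu2_ge: "real 39433053406024821513 / real 10000000000000000000 \<le> markov_lambda nu2_seq 0"
  by (rule lambda_ge_sound[OF ternary2_seqs(3) nu2_window]) code_simp+

lemma nu2_le: "markov_lambda nu2_seq 0 \<le> real 3943305341 / real 1000000000"
  by (rule lambda_le_sound[OF ternary2_seqs(3) nu2_window]) code_simp+

lemma mu2_ge: "real 3943307163 / real 1000000000 \<le> markov_lambda mu2_seq 0"
  by (rule lambda_ge_sound[OF ternary2_seqs(4) mu2_window]) code_simp+

lemma mu2_le: "markov_lambda mu2_seq 0 \<le> real 39433071635399640381 / real 10000000000000000000"
  by (rule lambda_le_sound[OF ternary2_seqs(4) mu2_window]) code_simp+


section \<open>Values away from the mark\<close>

lemma nu1_right:
  assumes "0 < j"
  shows "markov_lambda nu1_seq j \<le> real 39 / real 10"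
  unfolding nu1_seq_def
  by (rule marked_seq_lambda_right[OF ternary2_seqs(1)[unfolded nu1_seq_def],
      where m = 6 and n = 6 and bs = "replicate 2 False"],
      simp, simp, simp, simp, code_simp, simp, use assms in simp, use assms in \<open>auto simp: nth_append nth_Cons'\<close>)

text \<open>The exempted flag has list position 3, that is j = -4; this index is left to
  \<open>nu1_tie\<close>.\<close>

lemma nu1_left:
  assumes "j < 0" "j \<noteq> - 4"
  shows "markov_lambda nu1_seq j \<le> real 39 / real 10"
  unfolding nu1_seq_def
  by (rule marked_seq_lambda_left[OF ternary2_seqs(1)[unfolded nu1_seq_def],
      where m = 6 and n = 6 and bs = "replicate 3 False @ [True] @ replicate 2 False"],
      simp, simp, simp, simp, code_simp, simp, use assms in simp, use assms in \<open>auto simp: nth_append nth_Cons'\<close>)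

text \<open>A coarser bound that covers the tie at -4 as well. It makes \<open>nu1_seq\<close>
  admissible, so that \<open>nu1_core\<close> can be applied to this very sequence.\<close>

lemma nu1_left_all:
  assumes "j < 0"
  shows "markov_lambda nu1_seq j \<le> real 3945 / real 1000"
  unfolding nu1_seq_def
  by (rule marked_seq_lambda_left[OF ternary2_seqs(1)[unfolded nu1_seq_def],
      where m = 6 and n = 6 and bs = "replicate 6 False"],
      simp, simp, simp, simp, code_simp, simp, use assms in simp, use assms in \<open>auto simp: nth_append nth_Cons'\<close>)

text \<open>List position 8 is j = 9, the mirror image of the mark, treated in
  \<open>markov_lambda_mu1_9\<close>.\<close>

lemma mu1_right:
  assumes "0 < j" "j \<noteq> 9"
  shows "markov_lambda mu1_seq j \<le> real 39424 / real 10000"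
  unfolding mu1_seq_def
  by (rule marked_seq_lambda_right[OF ternary2_seqs(2)[unfolded mu1_seq_def],
      where m = 6 and n = 6 and bs = "replicate 8 False @ [True] @ replicate 19 False"],
      simp, simp, simp, simp, code_simp, simp, use assms in simp, use assms in \<open>auto simp: nth_append nth_Cons'\<close>)

lemma mu1_left:
  assumes "j < 0"
  shows "markov_lambda mu1_seq j \<le> real 39424 / real 10000"
  unfolding mu1_seq_def
  by (rule marked_seq_lambda_left[OF ternary2_seqs(2)[unfolded mu1_seq_def],
      where m = 6 and n = 6 and bs = "replicate 19 False"],
      simp, simp, simp, simp, code_simp, simp, use assms in simp, use assms in \<open>auto simp: nth_append nth_Cons'\<close>)

lemma nu2_right:
  assumes "0 < j"
  shows "markov_lambda nu2_seq j \<le> real 3932 / real 1000"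
  unfolding nu2_seq_def
  by (rule marked_seq_lambda_right[OF ternary2_seqs(3)[unfolded nu2_seq_def],
      where m = 6 and n = 6 and bs = "replicate 6 False"],
      simp, simp, simp, simp, code_simp, simp, use assms in simp, use assms in \<open>auto simp: nth_append nth_Cons'\<close>)

text \<open>List position 13 is j = -14, the mirror image of the mark, left to
  \<open>nu2_tie\<close>.\<close>

lemma nu2_left:
  assumes "j < 0" "j \<noteq> - 14"
  shows "markov_lambda nu2_seq j \<le> real 3932 / real 1000"
  unfolding nu2_seq_def
  by (rule marked_seq_lambda_left[OF ternary2_seqs(3)[unfolded nu2_seq_def],
      where m = 6 and n = 6 and bs = "replicate 13 False @ [True] @ replicate 6 False"],
      simp, simp, simp, simp, code_simp, simp, use assms in simp, use assms in \<open>auto simp: nth_append nth_Cons'\<close>)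

lemma nu2_left_all:
  assumes "j < 0"
  shows "markov_lambda nu2_seq j \<le> real 3945 / real 1000"
  unfolding nu2_seq_def
  by (rule marked_seq_lambda_left[OF ternary2_seqs(3)[unfolded nu2_seq_def],
      where m = 6 and n = 6 and bs = "replicate 20 False"],
      simp, simp, simp, simp, code_simp, simp, use assms in simp, use assms in \<open>auto simp: nth_append nth_Cons'\<close>)

lemma mu2_right:
  assumes "0 < j"
  shows "markov_lambda mu2_seq j \<le> real 39424 / real 10000"
  unfolding mu2_seq_def
  by (rule marked_seq_lambda_right[OF ternary2_seqs(4)[unfolded mu2_seq_def],
      where m = 6 and n = 6 and bs = "replicate 19 False"],
      simp, simp, simp, simp, code_simp, simp, use assms in simp, use assms in \<open>auto simp: nth_append nth_Cons'\<close>)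

lemma mu2_left:
  assumes "j < 0"
  shows "markov_lambda mu2_seq j \<le> real 39424 / real 10000"
  unfolding mu2_seq_def
  by (rule marked_seq_lambda_left[OF ternary2_seqs(4)[unfolded mu2_seq_def],
      where m = 6 and n = 6 and bs = "replicate 8 False"],
      simp, simp, simp, simp, code_simp, simp, use assms in simp, use assms in \<open>auto simp: nth_append nth_Cons'\<close>)

section \<open>Ties and attainment of the suprema\<close>

lemma nu1_admissible: "admissible nu1_seq"
proof -
  have "markov_lambda nu1_seq j < 79 / 20" for j
    using nu1_right[of j] nu1_left_all[of j] nu1_le by (cases j "0 :: int" rule: linorder_cases) auto
  then show ?thesis using ternary2_seqs(1) by (simp add: admissible_def)
qed

text \<open>The word is invariant under i \<mapsto> -4 - i, so index -4 sees the core with its sides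
  exchanged. After reflection, the extremality in \<open>nu1_core\<close> bounds the value
  there.\<close>

lemma nu1_tie: "markov_lambda nu1_seq (- 4) \<le> markov_lambda nu1_seq 0"
proof -
  have "window nu1_seq (- 4) core_r_nu1 3 core_l_nu1"
    by (simp add: window_def core_r_nu1_def core_l_nu1_def nu1_seq_def marked_seq_def
        eventually_periodic_def)
  then show ?thesis
    using nu1_core[OF admissible_reflect[OF nu1_admissible], of 4]
      markov_lambda_reflect[OF ternary2_seqs(1), of 4]
    by (simp add: window_reflect)
qed

lemma nu2_admissible: "admissible nu2_seq"
proof -
  have "markov_lambda nu2_seq j < 79 / 20" for j
    using nu2_right[of j] nu2_left_all[of j] nu2_le by (cases j "0 :: int" rule: linorder_cases) auto
  then show ?thesis using ternary2_seqs(3) by (simp add: admissible_def)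
qed

text \<open>The symmetry is now i \<mapsto> -14 - i, and the reflected core appears at index
  -14.\<close>

lemma nu2_tie: "markov_lambda nu2_seq (- 14) \<le> markov_lambda nu2_seq 0"
proof -
  have "window nu2_seq (- 14) core_r_nu2 3 core_l_nu2"
    by (simp add: window_def core_r_nu2_def core_l_nu2_def nu2_seq_def marked_seq_def
        eventually_periodic_def)
  then show ?thesis
    using nu2_core[OF admissible_reflect[OF nu2_admissible], of 14]
      markov_lambda_reflect[OF ternary2_seqs(3), of 14]
    by (simp add: window_reflect)
qed

lemma nu1_attained: "attained_at_mark nu1_seq"
proof (rule attained_at_markI)
  fix j
  show "markov_lambda nu1_seq j \<le> markov_lambda nu1_seq 0"
    using nu1_right[of j] nu1_left[of j] nu1_tie nu1_ge
    by (cases "j = - 4"; cases j "0 :: int" rule: linorder_cases) auto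
qed

lemma mu1_attained: "attained_at_mark mu1_seq"
proof (rule attained_at_markI)
  fix j
  show "markov_lambda mu1_seq j \<le> markov_lambda mu1_seq 0"
    using mu1_right[of j] mu1_left[of j] markov_lambda_mu1_9 mu1_ge
    by (cases "j = 9"; cases j "0 :: int" rule: linorder_cases) auto
qed

lemma nu2_attained: "attained_at_mark nu2_seq"
proof (rule attained_at_markI)
  fix j
  show "markov_lambda nu2_seq j \<le> markov_lambda nu2_seq 0"
    using nu2_right[of j] nu2_left[of j] nu2_tie nu2_ge
    by (cases "j = - 14"; cases j "0 :: int" rule: linorder_cases) auto
qed

lemma mu2_attained: "attained_at_mark mu2_seq"
proof (rule attained_at_markI)
  fix j
  show "markov_lambda mu2_seq j \<le> markov_lambda mu2_seq 0"
    using mu2_right[of j] mu2_left[of j] mu2_ge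
    by (cases "j = 0"; cases j "0 :: int" rule: linorder_cases) auto
qed

text \<open>The certificates are the output of a computer search with the rationals below, which are
  $\nu_i$ rounded down and $\mu_i$ rounded up. Coarser bounds on $\mu_1$ make
  the tree several times larger or infinite, because some of its branches come very close to it.\<close>

definition cert1 :: cert where
  "cert1 =
     SplitR (SplitL (HighR 0) (SplitR (SplitR (HighR 0) (SplitL (SplitL (HighR 0) (SplitR (SplitR
     (HighR 0) (SplitL (SplitL (HighR 0) (SplitR (SplitR (HighR 0) (HighR 0) (HighR 7)) (HighR 0)
     (HighR 0)) (HighL 5)) (HighR 0) (HighR 0)) (HighR 5)) (HighR 0) (HighR 0)) (HighL 3)) (HighR
     0) (HighR 0)) (SplitL (SplitL (SplitL (SplitR (HighR 3) (SplitL (HighR 0) (SplitR (HighR 0)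
     (HighR 3) (HighR 3)) (SplitR (SplitR (SplitL (HighL 5) (HighL 5) (SplitR (HighR 0) (HighR 3)
     (HighR 3))) (SplitL (HighL 5) (HighR 0) (HighR 0)) (HighR 6)) (HighR 3) (HighR 3))) (HighR
     0)) (HighR 0) (HighR 0)) Low Low) (HighR 0) (HighR 0))) (HighR 0) (HighR 0)) (SplitR (SplitR
     (SplitL Low Low (SplitR Low Low (SplitL (SplitR (HighR 0) (HighR 0) (SplitL (SplitL (HighR
     0) (HighR 0) (SplitR (SplitR (SplitL (HighL 5) (SplitR (SplitR (HighR 0) (SplitL (SplitL
     (HighL 5) (HighR 0) (HighR 0)) (HighL 5) (HighL 5)) (SplitL (SplitL (HighL 5) (SplitR (HighR
     9) (HighR 9) (SplitL (HighR 0) (HighR 0) (SplitR (HighR 0) (HighR 0) (SplitL (SplitL (SplitR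
     (SplitL (HighL 9) (HighL 9) (SplitR (SplitR (HighR 9) (HighR 9) (SplitL (HighR 0) (HighR 0)
     (SplitR (HighR 0) (SplitL (SplitR (SplitL (SplitR (HighR 0) (SplitL (SplitL (HighR 0)
     (SplitR (HighR 9) (HighR 9) (HighR 0)) (SplitR (HighR 9) (HighR 9) (SplitL (HighL 17) (HighL
     17) (SplitR (SplitR (SplitL (HighR 0) (HighR 0) (SplitR (HighR 0) (HighR 0) (SplitL (SplitR
     (HighR 9) (HighR 9) (SplitL (SplitL (HighL 17) (HighL 17) (SplitR (SplitR (SplitL (HighL 22)
     (HighL 17) (HighL 17)) (HighR 22) (HighR 22)) (HighR 9) (HighR 9))) (HighL 17) (HighL 17)))
     (SplitR (HighR 9) (HighR 9) (SplitL (HighR 0) (SplitR (HighR 0) (HighR 9) (HighR 9)) (SplitR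
     (SplitR (SplitL (HighL 21) (SplitR (SplitR (HighR 9) (HighR 9) (SplitL (HighR 0) (HighR 0)
     (SplitR (HighR 0) (HighR 26) (SplitL (HighL 23) (SplitL (SplitR (HighR 9) (HighR 0) (HighR
     0)) (SplitR (HighR 9) (HighR 9) (HighR 0)) (SplitR (HighR 9) (HighR 9) (SplitL (HighL 25)
     (SplitR (HighR 0) Core (HighR 9)) (SplitR (HighR 0) (HighR 0) (HighR 9))))) (HighR 0)))))
     (HighR 9) (HighR 9)) (SplitR (HighR 0) (HighR 9) (HighR 9))) (HighR 22) (HighR 0)) (HighR 9)
     (HighR 9)))) (SplitR (HighR 9) (HighR 9) (HighR 0))))) (HighR 0) (HighR 0)) (HighR 9) (HighR
     9))))) (HighR 0) (HighR 0)) (HighR 9)) (HighL 13) (HighL 13)) (HighR 14) (HighR 0)) (HighR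
     0) (HighR 0)) (HighR 9)))) (HighR 9) (HighR 9))) (SplitL (HighL 9) (HighR 0) (HighR 0))
     (SplitL (HighL 9) (HighR 0) (HighR 0))) (HighL 9) (HighL 9)) (HighR 0) (HighR 0))))) (HighL
     8)) (HighL 5) (HighL 5))) (HighR 0) (HighR 0)) (HighR 0)) (HighR 5) (HighR 5)) (HighR 0)
     (HighR 0))) (HighR 0) (HighR 0))) (SplitR (HighR 0) (HighR 4) (SplitL Low Low (SplitR Low
     Low (SplitL (HighL 4) (SplitR (HighR 4) Core Low) (SplitR (HighR 4) Low Low))))) (SplitR
     (HighR 4) Low Low)))) Low Low) (HighR 0) (HighR 0))) (SplitL (SplitL (SplitR (SplitL (HighR
     0) (SplitR (HighR 0) (SplitL (SplitL (HighR 0) (SplitR (SplitR (HighR 0) (SplitL (SplitL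
     (HighR 0) (HighR 0) (HighL 7)) (HighR 0) (HighR 0)) (HighR 5)) (HighR 0) (HighR 0)) (HighL
     5)) (HighR 0) (HighR 0)) (HighR 3)) (SplitR (SplitR (SplitL (HighL 3) (SplitR (HighR 0)
     (SplitL (HighR 0) (HighL 3) (HighL 3)) (SplitL (SplitL (SplitR (HighR 5) (HighR 5) (SplitL
     (HighR 0) (HighL 3) (HighL 3))) (SplitR (HighR 5) (HighR 0) (HighR 0)) (HighL 6)) (HighL 3)
     (HighL 3))) (HighR 0)) (HighR 0) (HighR 0)) Low Low)) (HighR 0) (HighR 0)) (HighR 0) (HighR
     0)) Low Low) (SplitL (SplitL (SplitL (SplitR Low Low (SplitL Low Low (SplitR (SplitL (HighR
     0) (HighR 0) (SplitR (SplitR (HighR 0) (HighR 0) (SplitL (SplitL (SplitR (HighR 5) (SplitL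
     (SplitL (HighR 0) (SplitR (SplitR (HighR 5) (HighR 0) (HighR 0)) (HighR 5) (HighR 5))
     (SplitR (SplitR (HighR 5) (SplitL (HighL 9) (HighL 9) (SplitR (HighR 0) (HighR 0) (SplitL
     (HighR 0) (HighR 0) (SplitR (SplitR (SplitL (SplitR (HighR 9) (HighR 9) (SplitL (SplitL
     (HighL 9) (HighL 9) (SplitR (HighR 0) (HighR 0) (SplitL (HighR 0) (SplitR (SplitL (SplitR
     (SplitL (HighR 0) (SplitR (SplitR (HighR 0) (SplitL (HighL 9) (HighL 9) (HighR 0)) (SplitL
     (HighL 9) (HighL 9) (SplitR (HighR 17) (HighR 17) (SplitL (SplitL (SplitR (HighR 0) (HighR
     0) (SplitL (HighR 0) (HighR 0) (SplitR (SplitL (HighL 9) (HighL 9) (SplitR (SplitR (HighR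
     17) (HighR 17) (SplitL (SplitL (SplitR (HighR 22) (HighR 17) (HighR 17)) (HighL 22) (HighL
     22)) (HighL 9) (HighL 9))) (HighR 17) (HighR 17))) (SplitL (HighL 9) (HighL 9) (SplitR
     (HighR 0) (SplitL (HighR 0) (HighL 9) (HighL 9)) (SplitL (SplitL (SplitR (HighR 21) (SplitL
     (SplitL (HighL 9) (HighL 9) (SplitR (HighR 0) (HighR 0) (SplitL (HighR 0) (HighL 26) (SplitR
     (HighR 23) (SplitR (SplitL (HighL 9) (HighR 0) (HighR 0)) (SplitL (HighL 9) (HighL 9) (HighR
     0)) (SplitL (HighL 9) (HighL 9) (SplitR (HighR 25) (SplitL (HighR 0) Core (HighL 9)) (SplitL
     (HighR 0) (HighR 0) (HighL 9))))) (HighR 0))))) (HighL 9) (HighL 9)) (SplitL (HighR 0)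
     (HighL 9) (HighL 9))) (HighL 22) (HighR 0)) (HighL 9) (HighL 9)))) (SplitL (HighL 9) (HighL
     9) (HighR 0))))) (HighR 0) (HighR 0)) (HighL 9) (HighL 9))))) (HighR 0) (HighR 0)) (HighL
     9)) (HighR 13) (HighR 13)) (HighL 14) (HighR 0)) (HighR 0) (HighR 0)) (HighL 9)))) (HighL 9)
     (HighL 9))) (SplitR (HighR 9) (HighR 0) (HighR 0)) (SplitR (HighR 9) (HighR 0) (HighR 0)))
     (HighR 9) (HighR 9)) (HighR 0) (HighR 0))))) (HighR 8)) (HighR 5) (HighR 5))) (HighR 0)
     (HighR 0)) (HighR 0)) (HighL 5) (HighL 5)) (HighR 0) (HighR 0))) (HighR 0) (HighR 0)))
     (SplitL (HighR 0) (HighL 4) (SplitR Low Low (SplitL Low Low (SplitR (HighR 4) (SplitL (HighL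
     4) Core Low) (SplitL (HighL 4) Low Low))))) (SplitL (HighL 4) Low Low)))) Low Low) (HighR 0)
     (HighR 0)) Low Low)"

lemma check_cert1:
  "check 394254221224894585350124 394330461351478987519153 100000000000000000000000
     cores1 cert1 [] []"
  by code_simp

definition cert2 :: cert where
  "cert2 =
     SplitR (SplitL (HighR 0) (SplitR (SplitR (HighR 0) (SplitL (SplitL (HighR 0) (SplitR (SplitR
     (HighR 0) (SplitL (SplitL (HighR 0) (SplitR (SplitR (HighR 0) (HighR 0) (HighR 7)) (HighR 0)
     (HighR 0)) (HighL 5)) (HighR 0) (HighR 0)) (HighR 5)) (HighR 0) (HighR 0)) (HighL 3)) (HighR
     0) (HighR 0)) (SplitL (SplitL (SplitL (SplitR (HighR 3) (SplitL (HighR 0) (SplitR (HighR 0)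
     (HighR 3) (HighR 3)) (SplitR (SplitR (SplitL Low (HighL 5) (SplitR (HighR 0) (HighR 3) Low))
     (SplitL (HighL 5) (HighR 0) (HighR 0)) (HighR 6)) Low Low)) (HighR 0)) (HighR 0) (HighR 0))
     Low Low) (HighR 0) (HighR 0))) (HighR 0) (HighR 0)) (SplitR (SplitR (SplitL Low Low (SplitR
     Low Low (SplitL (SplitR (HighR 0) (HighR 0) (SplitL (SplitL (HighR 0) (HighR 0) (SplitR
     (SplitR (SplitL (HighL 5) (SplitR (SplitR (SplitL (HighR 0) (HighR 0) (HighL 5)) (SplitL
     (SplitL (HighL 5) (SplitR (SplitR (HighR 0) (SplitL (HighR 0) (HighR 0) (SplitR (SplitR
     (HighR 0) (SplitL (SplitL (SplitR (SplitL (HighL 9) (HighL 9) (SplitR (HighR 0) (SplitR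
     (SplitL (HighR 0) (HighR 0) (SplitR (HighR 0) (SplitL (SplitR (SplitL (SplitR (HighR 0)
     (SplitL (SplitR (SplitL (HighR 0) (HighR 0) (SplitR (HighR 0) (SplitL (HighL 17) (HighL 17)
     (SplitR (SplitR (HighR 0) (SplitL (HighR 0) (HighR 0) (SplitR (SplitR (HighR 0) (SplitL
     (SplitR (SplitL (SplitR (SplitL (HighL 17) (HighL 17) (SplitR (SplitR (SplitL (HighL 22)
     (HighL 17) (HighL 17)) (SplitL (HighL 22) (HighL 17) (HighL 17)) (SplitL (HighL 22) (HighL
     17) (HighL 17))) (SplitL (HighL 22) (HighL 17) (HighL 17)) (SplitL (HighL 22) (HighL 17)
     (HighL 17)))) (SplitL (HighL 17) (HighL 17) (SplitR (SplitL (HighL 22) (HighL 17) (HighL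
     17)) (SplitL (HighL 22) (HighL 17) (HighL 17)) (SplitL (HighL 22) (HighL 17) (HighL 17))))
     (HighR 27)) (HighL 17) (HighL 17)) (SplitL (SplitL (HighL 17) (HighL 17) (HighR 0)) (HighL
     17) (HighL 17)) (SplitL (HighR 0) (HighL 17) (HighL 17))) Core (HighR 0)) (HighR 25)) (HighR
     0) (HighR 0))) (HighR 23)) (HighR 0) (HighR 0))) (HighR 21))) (HighR 0) (HighR 0)) (HighR 0)
     (HighR 0)) (HighR 19)) (HighL 13) (HighL 13)) (HighR 0) (HighR 0)) (HighR 0) (HighR 0))
     (HighR 17))) (HighR 0) (HighR 0)) (HighR 15))) (SplitL (HighL 9) (HighR 0) (HighR 0)) (HighR
     0)) (HighL 9) (HighL 9)) (HighR 0) (HighR 0)) (HighR 13)) (HighR 0) (HighR 0))) (HighR 11))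
     (HighR 0) (HighR 0)) (HighR 0)) (HighL 5) Low) (SplitL (SplitL Low (SplitR Low Low (SplitL
     (SplitL Low (SplitR (SplitR (SplitL (SplitR (SplitL Low (SplitR Low Low (SplitL (SplitL
     (SplitR (HighR 14) Low Low) (SplitR (HighR 14) (HighR 14) (SplitL (SplitL Low (SplitR Low
     Low (SplitL (SplitR (SplitL (SplitR Low Low (HighR 14)) (SplitR (SplitL (SplitR (HighR 14)
     (HighR 14) (SplitL Low (SplitR Low Core (HighR 14)) (HighL 20))) (SplitR (HighR 14) Low Low)
     (SplitR (HighR 14) Low Low)) (HighR 14) (HighR 14)) (HighL 18)) Low Low) Low Low)) (HighL
     16)) Low Low)) (HighL 14)) Low Low)) (HighL 12)) Low Low) Low Low) (HighR 10) (HighR 10))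
     Low Low) (HighL 10)) Low Low)) (HighL 8)) Low Low)) (HighR 0) (HighR 0)) (HighR 0)) Low Low)
     (HighR 0) (HighR 0))) (HighR 0) (HighR 0))) (SplitR (HighR 0) (HighR 4) Low) (SplitR (HighR
     4) Low Low)))) Low Low) (HighR 0) (HighR 0))) (SplitL (SplitL (SplitR (SplitL (HighR 0)
     (SplitR (HighR 0) (SplitL (SplitL (HighR 0) (SplitR (SplitR (HighR 0) (SplitL (SplitL (HighR
     0) (HighR 0) (HighL 7)) (HighR 0) (HighR 0)) (HighR 5)) (HighR 0) (HighR 0)) (HighL 5))
     (HighR 0) (HighR 0)) (HighR 3)) (SplitR (SplitR (SplitL (HighL 3) (SplitR (HighR 0) (SplitL
     (HighR 0) (HighL 3) (HighL 3)) (SplitL (SplitL (SplitR Low (HighR 5) (SplitL (HighR 0)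
     (HighL 3) Low)) (SplitR (HighR 5) (HighR 0) (HighR 0)) (HighL 6)) Low Low)) (HighR 0))
     (HighR 0) (HighR 0)) Low Low)) (HighR 0) (HighR 0)) (HighR 0) (HighR 0)) Low Low) (SplitL
     (SplitL (SplitL (SplitR Low Low (SplitL Low Low (SplitR (SplitL (HighR 0) (HighR 0) (SplitR
     (SplitR (HighR 0) (HighR 0) (SplitL (SplitL (SplitR (HighR 5) (SplitL (SplitL (SplitR (HighR
     0) (HighR 0) (HighR 5)) (SplitR (SplitR (HighR 5) (SplitL (SplitL (HighR 0) (SplitR (HighR
     0) (HighR 0) (SplitL (SplitL (HighR 0) (SplitR (SplitR (SplitL (SplitR (HighR 9) (HighR 9)
     (SplitL (HighR 0) (SplitL (SplitR (HighR 0) (HighR 0) (SplitL (HighR 0) (SplitR (SplitL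
     (SplitR (SplitL (HighR 0) (SplitR (SplitL (SplitR (HighR 0) (HighR 0) (SplitL (HighR 0)
     (SplitR (HighR 17) (HighR 17) (SplitL (SplitL (HighR 0) (SplitR (HighR 0) (HighR 0) (SplitL
     (SplitL (HighR 0) (SplitR (SplitL (SplitR (SplitL (SplitR (HighR 17) (HighR 17) (SplitL
     (SplitL (SplitR (HighR 22) (HighR 17) (HighR 17)) (SplitR (HighR 22) (HighR 17) (HighR 17))
     (SplitR (HighR 22) (HighR 17) (HighR 17))) (SplitR (HighR 22) (HighR 17) (HighR 17)) (SplitR
     (HighR 22) (HighR 17) (HighR 17)))) (SplitR (HighR 17) (HighR 17) (SplitL (SplitR (HighR 22)
     (HighR 17) (HighR 17)) (SplitR (HighR 22) (HighR 17) (HighR 17)) (SplitR (HighR 22) (HighR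
     17) (HighR 17)))) (HighL 27)) (HighR 17) (HighR 17)) (SplitR (SplitR (HighR 17) (HighR 17)
     (HighR 0)) (HighR 17) (HighR 17)) (SplitR (HighR 0) (HighR 17) (HighR 17))) Core (HighR 0))
     (HighL 25)) (HighR 0) (HighR 0))) (HighL 23)) (HighR 0) (HighR 0))) (HighL 21))) (HighR 0)
     (HighR 0)) (HighR 0) (HighR 0)) (HighL 19)) (HighR 13) (HighR 13)) (HighR 0) (HighR 0))
     (HighR 0) (HighR 0)) (HighL 17))) (HighR 0) (HighR 0)) (HighL 15))) (SplitR (HighR 9) (HighR
     0) (HighR 0)) (HighR 0)) (HighR 9) (HighR 9)) (HighR 0) (HighR 0)) (HighL 13)) (HighR 0)
     (HighR 0))) (HighL 11)) (HighR 0) (HighR 0)) (HighR 0)) (HighR 5) Low) (SplitR (SplitR Low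
     (SplitL Low Low (SplitR (SplitR Low (SplitL (SplitL (SplitR (SplitL (SplitR Low (SplitL Low
     Low (SplitR (SplitR (SplitL (HighL 14) Low Low) (SplitL (HighL 14) (HighL 14) (SplitR
     (SplitR Low (SplitL Low Low (SplitR (SplitL (SplitR (SplitL Low Low (HighL 14)) (SplitL
     (SplitR (SplitL (HighL 14) (HighL 14) (SplitR Low (SplitL Low Core (HighL 14)) (HighR 20)))
     (SplitL (HighL 14) Low Low) (SplitL (HighL 14) Low Low)) (HighL 14) (HighL 14)) (HighR 18))
     Low Low) Low Low)) (HighR 16)) Low Low)) (HighR 14)) Low Low)) (HighR 12)) Low Low) Low Low)
     (HighL 10) (HighL 10)) Low Low) (HighR 10)) Low Low)) (HighR 8)) Low Low)) (HighR 0) (HighR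
     0)) (HighR 0)) Low Low) (HighR 0) (HighR 0))) (HighR 0) (HighR 0))) (SplitL (HighR 0) (HighL
     4) Low) (SplitL (HighL 4) Low Low)))) Low Low) (HighR 0) (HighR 0)) Low Low)"

lemma check_cert2:
  "check 39433053406024821513 39433071635399640381 10000000000000000000
     cores2 cert2 [] []"
  by code_simp


section \<open>The two gaps\<close>

lemma gap1: "{markov_lambda nu1_seq 0<..<markov_lambda mu1_seq 0} \<inter> markov_spectrum = {}"
proof (rule spectrum_gapI[OF _ nu1_ge mu1_le _ _ _ check_cert1])
  have no_core: "\<not> window a 0 core_l_nu1 3 core_r_nu1" "\<not> window a 0 core_l_mu1 3 core_r_mu1"
    if "admissible a" "\<And>i. markov_lambda a i < markov_lambda mu1_seq 0"
      "markov_lambda nu1_seq 0 < markov_lambda a 0" for a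
    using nu1_core[of a 0] mu1_core[of a] that by (auto simp: not_le[symmetric])
  fix a cl cr
  assume a: "admissible a" "\<And>i. markov_lambda a i < markov_lambda mu1_seq 0"
    "markov_lambda nu1_seq 0 < markov_lambda a 0" and "(cl, cr) \<in> set cores1"
  \<comment> \<open>A core with exchanged sides is an ordinary core of the reflected sequence, which
    has the same value at 0 and obeys the same bound everywhere.\<close>
  moreover have "markov_lambda (\<lambda>i. a (- i)) i = markov_lambda a (- i)" for i
    using a(1) by (simp add: admissible_def markov_lambda_reflect)
  ultimately show "\<not> window a 0 cl 3 cr"
    using no_core[of a] no_core[of "\<lambda>i. a (- i)"] admissible_reflect[OF a(1)]
    by (auto simp: cores1_def window_reflect)
qed (use mu1_le in simp_all)

lemma gap2: "{markov_lambda nu2_seq 0<..<markov_lambda mu2_seq 0} \<inter> markov_spectrum = {}"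
proof (rule spectrum_gapI[OF _ nu2_ge mu2_le _ _ _ check_cert2])
  have no_core: "\<not> window a 0 core_l_nu2 3 core_r_nu2" "\<not> window a 0 core_l_mu2 3 core_r_mu2"
    if "admissible a" "\<And>i. markov_lambda a i < markov_lambda mu2_seq 0"
      "markov_lambda nu2_seq 0 < markov_lambda a 0" for a
    using nu2_core[of a 0] mu2_core[of a 0] that by (auto simp: not_le[symmetric])
  fix a cl cr
  assume a: "admissible a" "\<And>i. markov_lambda a i < markov_lambda mu2_seq 0"
    "markov_lambda nu2_seq 0 < markov_lambda a 0" and "(cl, cr) \<in> set cores2"
  moreover have "markov_lambda (\<lambda>i. a (- i)) i = markov_lambda a (- i)" for i
    using a(1) by (simp add: admissible_def markov_lambda_reflect)
  ultimately show "\<not> window a 0 cl 3 cr"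
    using no_core[of a] no_core[of "\<lambda>i. a (- i)"] admissible_reflect[OF a(1)]
    by (auto simp: cores2_def window_reflect)
qed (use mu2_le in simp_all)

theorem theorem1p4:
  shows "attained_at_mark nu1_seq \<and> 3.94254 \<le> nu1 \<and> nu1 < 3.94255 \<and>
    attained_at_mark mu1_seq \<and> 3.943304 \<le> mu1 \<and> mu1 < 3.943305 \<and>
    attained_at_mark nu2_seq \<and> 3.94330534 \<le> nu2 \<and> nu2 < 3.94330535 \<and>
    attained_at_mark mu2_seq \<and> 3.94330716 \<le> mu2 \<and> mu2 < 3.94330717 \<and>
    {nu1<..<mu1} \<inter> markov_spectrum = {} \<and> nu1 \<in> markov_spectrum \<and> mu1 \<in> markov_spectrum \<and>
    {nu2<..<mu2} \<inter> markov_spectrum = {} \<and> nu2 \<in> markov_spectrum \<and> mu2 \<in> markov_spectrum"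
proof -
  have val: "nu1 = markov_lambda nu1_seq 0" "mu1 = markov_lambda mu1_seq 0"
    "nu2 = markov_lambda nu2_seq 0" "mu2 = markov_lambda mu2_seq 0"
    using nu1_attained mu1_attained nu2_attained mu2_attained
    by (simp_all add: attained_at_mark_def nu1_def mu1_def nu2_def mu2_def)
  have spec: "nu1 \<in> markov_spectrum" "mu1 \<in> markov_spectrum"
    "nu2 \<in> markov_spectrum" "mu2 \<in> markov_spectrum"
    unfolding nu1_def mu1_def nu2_def mu2_def
    using nu1_attained mu1_attained nu2_attained mu2_attained ternary2_seqs
    by (auto intro: attained_in_spectrum)
  have "3.94254 \<le> nu1 \<and> nu1 < 3.94255" "3.943304 \<le> mu1 \<and> mu1 < 3.943305"
    "3.94330534 \<le> nu2 \<and> nu2 < 3.94330535" "3.94330716 \<le> mu2 \<and> mu2 < 3.94330717"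
    unfolding val using nu1_ge nu1_le mu1_ge mu1_le nu2_ge nu2_le mu2_ge mu2_le by simp_all
  then show ?thesis
    using nu1_attained mu1_attained nu2_attained mu2_attained spec gap1 gap2
    by (simp add: val)
qed

end
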